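(* Let $v\in I(d)$. Let $\mathfrak S$ be a special monomial, and set $\pi(\mathfrak S)=(t,\mathfrak S')$ and $\pi(\mathfrak S')=(u,\mathfrak T)$. Then: (1) $t\ge u\ge v$, $t^\#=t$, $u^\#=u$, and the $(1,\dots,d)$-degrees of $t$ and $u$ are equal (i.e. $|t\setminus[d]|=|u\setminus[d]|$); (2) $\mathfrak T$ is special and $u$ dominates $\mathfrak T$. Conversely, if $t,u\in I(d,2d)$ and $\mathfrak T$ is a monomial in $\mathfrak N^v$ such that conditions (1) and (2) are satisfied, then $\phi(t,\phi(u,\mathfrak T))$ is special.
   Context: Fix a positive integer $d$; $[2d]=\{1,\dots,2d\}$, $j^*:=2d+1-j$. $I(d,2d)$ is the set of $d$-element subsets of $[2d]$, with $u\le x$ iff the $i$-th smallest element of $u$ is at most that of $x$ for every $i$; $I(d)\subseteq I(d,2d)$ consists of the subsets containing exactly one of $j,j^*$ for each $j\in[d]$. For $u\in I(d,2d)$, $u^*:=\{j^*:j\in u\}$ and $u^\#:=[2d]\setminus u^*$; $u=u^\#$ iff $u\in I(d)$. Let $\mathfrak N^v=\{(r,c):r\in[2d]\setminus v,\ c\in v,\ r>c\}$. Monomials in $\mathfrak N^v$ are finite (possibly empty) multisets on $\mathfrak N^v$. Write $(R,C)>(r,c)$ if $R>r$ and $C<c$. An element $w\in I(d,2d)$ dominates a monomial if for every (possibly empty) sequence $(r_1,c_1)>\dots>(r_t,c_t)$ of its elements, $w\ge(v\setminus\{c_1,\dots,c_t\})\cup\{r_1,\dots,r_t\}$. The map $\pi$.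 An element $\beta$ of a monomial $\mathfrak S$ is $j$-deep in $\mathfrak S$ if there are elements $\beta_1>\dots>\beta_j=\beta$ of $\mathfrak S$. Let $\mathfrak S_j$ be the multiset of elements of $\mathfrak S$ (with multiplicities) that are $j$-deep but not $(j+1)$-deep; it can be arranged as $(r_1,c_1),\dots,(r_p,c_p)$ with $r_1\le\dots\le r_p$, $c_1\le\dots\le c_p$. Consecutive members $(r_i,c_i),(r_{i+1},c_{i+1})$ are related if $r_i>c_{i+1}$; the blocks of $\mathfrak S_j$ are the classes of the generated equivalence relation, and the blocks of $\mathfrak S$ are those of all the $\mathfrak S_j$. For a block $\mathfrak B$ with members $(a_1,b_1),\dots,(a_q,b_q)$ in this order, $w(\mathfrak B):=(a_q,b_1)$ and $\mathfrak B':=\{(a_1,b_2),\dots,(a_{q-1},b_q)\}$ (multiset). Put $\mathfrak S':=\bigcup_{\mathfrak B}\mathfrak B'$, let $w$ be obtained from $v$ by removing the second coordinates and adding the first coordinates of all $w(\mathfrak B)$, and set $\pi(\mathfrak S):=(w,\mathfrak S')$; $\pi(\emptyset):=(v,\emptyset)$. It is known (Kodiyalam–Raghavan) that $\pi$ is a bijection from nonempty monomials in $\mathfrak N^v$ onto pairs $(w,\mathfrak T)$ with $w\in I(d,2d)$, $w>v$ and $\mathfrak T$ a monomial dominated by $w$, and that $w$ is the least element of $I(d,2d)$ dominating $\mathfrak S$. $\phi$ denotes the inverse of $\pi$, with $\phi(v,\emptyset)=\emptyset$. For $\alpha=(r,c)\in\mathfrak N^v$, $\alpha^\#:=(c^*,r^*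 )\in\mathfrak N^v$; $\mathfrak S^\#$ is obtained by applying $\#$ elementwise. Diagonal elements are those of the form $(r,r^* )$. A monomial $\mathfrak S$ is special if $\mathfrak S=\mathfrak S^\#$ and every diagonal element has even multiplicity in $\mathfrak S$. *)

theory Defs
  imports "HOL-Library.Multiset"
begin

definition star :: "nat \<Rightarrow> nat \<Rightarrow> nat" where
  "star d j = 2 * d + 1 - j"

definition subsets_d :: "nat \<Rightarrow> nat set set" where
  "subsets_d d = {u. u \<subseteq> {1..2 * d} \<and> card u = d}"

definition sym_subsets_d :: "nat \<Rightarrow> nat set set" where
  "sym_subsets_d d =
     {u \<in> subsets_d d. \<forall>j \<in> {1..d}. (j \<in> u) \<noteq> (star d j \<in> u)}"

text \<open>The order on \<^term>\<open>subsets_d d\<close>. Membership in \<^term>\<open>subsets_d d\<close> is not part of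
  the relation; it is only meaningful for two sets of the same finite cardinality.\<close>

definition set_le :: "nat set \<Rightarrow> nat set \<Rightarrow> bool" where
  "set_le u x \<longleftrightarrow>
     (\<forall>i < card u. sorted_list_of_set u ! i \<le> sorted_list_of_set x ! i)"

definition set_sharp :: "nat \<Rightarrow> nat set \<Rightarrow> nat set" where
  "set_sharp d u = {1..2 * d} - star d ` u"

text \<open>The degree with respect to \<open>{1..d}\<close>.\<close>

definition deg :: "nat \<Rightarrow> nat set \<Rightarrow> nat" where
  "deg d u = card (u - {1..d})"

definition roots :: "nat \<Rightarrow> nat set \<Rightarrow> (nat \<times> nat) set" where
  "roots d v = {(r, c). r \<in> {1..2 * d} - v \<and> c \<in> v \<and> r > c}"

definition monomial :: "nat \<Rightarrow> nat set \<Rightarrow> (nat \<times> nat) multiset \<Rightarrow> bool" where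
  "monomial d v S \<longleftrightarrow> set_mset S \<subseteq> roots d v"

definition gt :: "nat \<times> nat \<Rightarrow> nat \<times> nat \<Rightarrow> bool" where
  "gt \<alpha> \<beta> \<longleftrightarrow> fst \<alpha> > fst \<beta> \<and> snd \<alpha> < snd \<beta>"

definition chain_in :: "(nat \<times> nat) multiset \<Rightarrow> (nat \<times> nat) list \<Rightarrow> bool" where
  "chain_in S xs \<longleftrightarrow> set xs \<subseteq> set_mset S \<and> sorted_wrt gt xs"

definition dominates :: "nat set \<Rightarrow> nat set \<Rightarrow> (nat \<times> nat) multiset \<Rightarrow> bool" where
  "dominates v w S \<longleftrightarrow>
     (\<forall>xs. chain_in S xs \<longrightarrow> set_le ((v - snd ` set xs) \<union> fst ` set xs) w)"

definition deep :: "(nat \<times> nat) multiset \<Rightarrow> nat \<Rightarrow> nat \<times> nat \<Rightarrow> bool" where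
  "deep S j \<beta> \<longleftrightarrow>
     (\<exists>xs. chain_in S xs \<and> length xs = j \<and> xs \<noteq> [] \<and> last xs = \<beta>)"

definition layer :: "(nat \<times> nat) multiset \<Rightarrow> nat \<Rightarrow> (nat \<times> nat) multiset" where
  "layer S j = filter_mset (\<lambda>\<beta>. deep S j \<beta> \<and> \<not> deep S (j + 1) \<beta>) S"

definition arrangement :: "(nat \<times> nat) multiset \<Rightarrow> (nat \<times> nat) list" where
  "arrangement M =
     (THE xs. mset xs = M \<and> sorted (map fst xs) \<and> sorted (map snd xs))"

text \<open>The arrangement is well defined as soon as no two elements of the multiset are
  comparable under \<^const>\<open>gt\<close>; this is the case for every layer.\<close>

lemma arrangement_ex1:
  assumes incomp: "\<And>\<alpha> \<beta>. \<alpha> \<in># M \<Longrightarrow> \<beta> \<in># M \<Longrightarrow> \<not> gt \<alpha> \<beta>"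
  shows "\<exists>!xs. mset xs = M \<and> sorted (map fst xs) \<and> sorted (map snd xs)"
proof (rule ex_ex1I)
  obtain ys where ys: "mset ys = M"
    using ex_mset by blast
  define xs where "xs = sort_key (\<lambda>p. fst p + snd p) ys"
  have M: "mset xs = M" and st: "sorted (map (\<lambda>p. fst p + snd p) xs)"
    by (simp_all add: xs_def ys)
  have "sorted_wrt (\<lambda>p q. fst p + snd p \<le> fst q + snd q) xs"
    using st by (simp add: sorted_wrt_map)
  then have "sorted_wrt (\<lambda>p q. fst p \<le> fst q \<and> snd p \<le> snd q) xs"
  proof (rule sorted_wrt_mono_rel[rotated])
    fix p q
    assume "p \<in> set xs" "q \<in> set xs" and le: "fst p + snd p \<le> fst q + snd q"
    then have "\<not> gt p q" "\<not> gt q p"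
      using incomp[of p q] incomp[of q p] by (simp_all flip: M)
    then show "fst p \<le> fst q \<and> snd p \<le> snd q"
      using le by (auto simp: gt_def)
  qed
  then have "sorted (map fst xs)" "sorted (map snd xs)"
    by (auto simp: sorted_wrt_map elim: sorted_wrt_mono_rel[rotated])
  with M show "\<exists>xs. mset xs = M \<and> sorted (map fst xs) \<and> sorted (map snd xs)"
    by blast
next
  fix xs ys :: "(nat \<times> nat) list"
  assume xs: "mset xs = M \<and> sorted (map fst xs) \<and> sorted (map snd xs)"
    and ys: "mset ys = M \<and> sorted (map fst ys) \<and> sorted (map snd ys)"
  have "map f xs = map f ys" if "sorted (map f xs)" "sorted (map f ys)" for f :: "nat \<times> nat \<Rightarrow> nat"
    using that xs ys by (metis mset_map properties_for_sort)
  then show "xs = ys"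
    using xs ys by (metis zip_map_fst_snd)
qed

lemma layer_incomparable:
  assumes "\<alpha> \<in># layer S j" "\<beta> \<in># layer S j"
  shows "\<not> gt \<alpha> \<beta>"
proof
  assume g: "gt \<alpha> \<beta>"
  from assms(1) obtain xs where xs: "chain_in S xs" "length xs = j" "xs \<noteq> []" "last xs = \<alpha>"
    by (auto simp: layer_def deep_def)
  have "gt \<gamma> \<beta>" if "\<gamma> \<in> set xs" for \<gamma>
  proof -
    have "xs = butlast xs @ [\<alpha>]"
      using xs by (metis append_butlast_last_id)
    then have "sorted_wrt gt (butlast xs @ [\<alpha>])" "\<gamma> \<in> set (butlast xs @ [\<alpha>])"
      using xs(1) that by (auto simp: chain_in_def)
    then show ?thesis
      using g by (auto simp: sorted_wrt_append gt_def)
  qed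
  then have "chain_in S (xs @ [\<beta>])"
    using xs(1) assms(2) by (auto simp: chain_in_def sorted_wrt_append layer_def)
  then have "deep S (j + 1) \<beta>"
    unfolding deep_def using xs(2) by (intro exI[of _ "xs @ [\<beta>]"]) auto
  then show False
    using assms(2) by (simp add: layer_def)
qed

text \<open>Blocks are equivalence classes of positions in the arrangement rather than of
  elements, so that multiplicities are kept.\<close>

definition related :: "(nat \<times> nat) list \<Rightarrow> (nat \<times> nat) set" where
  "related xs = {(i, Suc i) |i. Suc i < length xs \<and> fst (xs ! i) > snd (xs ! Suc i)}"

definition block_positions :: "(nat \<times> nat) list \<Rightarrow> nat set set" where
  "block_positions xs = {..<length xs} // (related xs \<union> (related xs)\<inverse>)\<^sup>*"

text \<open>A block of \<open>S\<close> is indexed by its layer number and its set of positions there.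
  Layers beyond the size of \<open>S\<close> are empty.\<close>

definition block_indices :: "(nat \<times> nat) multiset \<Rightarrow> (nat \<times> nat set) set" where
  "block_indices S = (SIGMA j:{1..size S}. block_positions (arrangement (layer S j)))"

definition block :: "(nat \<times> nat) multiset \<Rightarrow> nat \<times> nat set \<Rightarrow> (nat \<times> nat) list" where
  "block S = (\<lambda>(j, A). nths (arrangement (layer S j)) A)"

definition block_w :: "(nat \<times> nat) list \<Rightarrow> nat \<times> nat" where
  "block_w B = (fst (last B), snd (hd B))"

definition block_prime :: "(nat \<times> nat) list \<Rightarrow> (nat \<times> nat) multiset" where
  "block_prime B = mset (zip (map fst (butlast B)) (map snd (tl B)))"

definition KR_pi ::
    "nat set \<Rightarrow> (nat \<times> nat) multiset \<Rightarrow> nat set \<times> (nat \<times> nat) multiset" where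
  "KR_pi v S =
     (let W = (\<lambda>b. block_w (block S b)) ` block_indices S
      in ((v - snd ` W) \<union> fst ` W, \<Sum>b \<in> block_indices S. block_prime (block S b)))"

text \<open>The empty monomial has no blocks, so it needs no separate clause.\<close>

lemma KR_pi_empty: "KR_pi v {#} = (v, {#})"
  by (simp add: KR_pi_def block_indices_def)

text \<open>The inverse of \<^const>\<open>KR_pi\<close> on all monomials, including the empty one. Its value at
  pairs outside the image, that is, other than \<open>(v, {#})\<close> and the pairs \<open>(w, T)\<close> with
  \<open>w > v\<close> dominating \<open>T\<close>, is irrelevant.\<close>

definition KR_phi ::
    "nat \<Rightarrow> nat set \<Rightarrow> nat set \<times> (nat \<times> nat) multiset \<Rightarrow> (nat \<times> nat) multiset" where
  "KR_phi d v = inv_into {S. monomial d v S} (KR_pi v)"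

definition root_sharp :: "nat \<Rightarrow> nat \<times> nat \<Rightarrow> nat \<times> nat" where
  "root_sharp d = (\<lambda>(r, c). (star d c, star d r))"

definition special :: "nat \<Rightarrow> nat set \<Rightarrow> (nat \<times> nat) multiset \<Rightarrow> bool" where
  "special d v S \<longleftrightarrow>
     monomial d v S \<and> image_mset (root_sharp d) S = S \<and>
     (\<forall>r c. (r, c) \<in># S \<and> c = star d r \<longrightarrow> even (count S (r, c)))"

end

(* Let depth S y x be the largest length of a chain of S in the quadrant {(r,c) : r > y, c <= x}.
   In terms of depths the map pi has no blocks: if pi(S) = (w,S'), then depth S z z is the number of
   elements up to z that v has in excess of w, and for x <= y the quadrant at (y,x) holds depth S y x
   more elements of S than of S' (each nonempty layer in it loses exactly one). Together with the
   recursion for depths this is a growth diagram that can be run in both directions, which gives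
   injectivity and surjectivity of pi, and dominance becomes the bound depth S z z <= |v[z]| - |w[z]|.
   Reflection in the antidiagonal preserves the relation, so symmetry passes both ways through pi.
   On an antidiagonal cell of a symmetric S, the multiplicities in S and S' have a sum congruent mod 2
   to the increment of depth along the antidiagonal. That increment is 0 or 1, it is 1 if S or S' has
   an element there, and the increments add up to depth S d d, the excess of v over w in [d].
   Hence equality of degrees for two successive steps S, S', T means equality of all increments,
   and this is what ties even multiplicities in S to even multiplicities in T. *)
theory Submission
  imports Defs
begin

text \<open>The blocks force the region x <= y. Primes of blocks are made of the pairs (r_i,
  c_{i+1}) of consecutive members of a layer, and the pairs lost between blocks are those with r_i
  <= c_{i+1}; such a pair lies in no quadrant with x <= y. On this region pi therefore acts as a
  plain shift of each layer, and the cuts between blocks are visible only on the diagonal, where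
  they produce w. In the growth diagram S determines the outer corner of a cell from the other
  three, and S' determines the inner one. The first recursion starts from the left and top boundary,
  where depths vanish, the second from the diagonal, where w prescribes them. Cell by cell, parity
  yields only a one-sided comparison of increments. Even multiplicities in S make each increment of
  S at most that of S'; even multiplicities in T make it at least that of S'. The totals then
  decide. In the first case \<open>depth S' d d <= depth S d d\<close>, which always holds, closes
  the argument, so equality of degrees comes out as a conclusion; in the second case it is the
  hypothesis that closes it.\<close>

section \<open>Chains in quadrants\<close>

text \<open>The half-open shape serves two purposes: \<open>quadrant z z\<close> consists of the
  pairs (r, c) with c <= z < r, whose exchange lowers the count up to the cut z, and the four
  quadrants at the corners of a unit cell differ in inclusion-exclusion by the single pair
  \<open>(Suc y, Suc x)\<close>.\<close>

definition quadrant :: "nat \<Rightarrow> nat \<Rightarrow> (nat \<times> nat) set" where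
  "quadrant y x = {p. y < fst p \<and> snd p \<le> x}"

definition qcount :: "(nat \<times> nat) multiset \<Rightarrow> nat \<Rightarrow> nat \<Rightarrow> nat" where
  "qcount S y x = size (filter_mset (\<lambda>p. p \<in> quadrant y x) S)"

definition depth :: "(nat \<times> nat) multiset \<Rightarrow> nat \<Rightarrow> nat \<Rightarrow> nat" where
  "depth S y x = Max (length ` {xs. chain_in S xs \<and> set xs \<subseteq> quadrant y x})"

lemma gt_irrefl: "\<not> gt p p"
  by (simp add: gt_def)

lemma chain_in_Nil: "chain_in S []"
  by (simp add: chain_in_def)

lemma chain_in_append:
  "chain_in S (xs @ ys) \<longleftrightarrow> chain_in S xs \<and> chain_in S ys \<and> (\<forall>p\<in>set xs. \<forall>q\<in>set ys. gt p q)"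
  by (auto simp: chain_in_def sorted_wrt_append)

lemma distinct_chain: "chain_in S xs \<Longrightarrow> distinct xs"
  by (induction xs) (auto simp: chain_in_def gt_irrefl)

lemma length_chain_le: "chain_in S xs \<Longrightarrow> length xs \<le> card (set_mset S)"
  by (metis card_mono chain_in_def distinct_card distinct_chain finite_set_mset)

lemma finite_chain_lengths:
  "finite (length ` {xs. chain_in S xs \<and> set xs \<subseteq> A})"
  by (rule finite_subset[of _ "{..card (set_mset S)}"]) (auto dest: length_chain_le)

text \<open>Prefixes of chains are chains, so every length below the maximum occurs; the empty chain
  makes the maximum well defined.\<close>

lemma le_depth_iff:
  "k \<le> depth S y x \<longleftrightarrow> (\<exists>xs. chain_in S xs \<and> set xs \<subseteq> quadrant y x \<and> length xs = k)"
proof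
  let ?L = "length ` {xs. chain_in S xs \<and> set xs \<subseteq> quadrant y x}"
  have "?L \<noteq> {}"
    using chain_in_Nil by force
  then have "depth S y x \<in> ?L"
    unfolding depth_def by (intro Max_in finite_chain_lengths)
  then obtain xs where xs: "chain_in S xs" "set xs \<subseteq> quadrant y x" "length xs = depth S y x"
    by auto
  assume "k \<le> depth S y x"
  then have "chain_in S (take k xs)" "set (take k xs) \<subseteq> quadrant y x" "length (take k xs) = k"
    using xs by (auto simp: chain_in_def sorted_wrt_take dest: in_set_takeD)
  then show "\<exists>xs. chain_in S xs \<and> set xs \<subseteq> quadrant y x \<and> length xs = k"
    by blast
next
  assume "\<exists>xs. chain_in S xs \<and> set xs \<subseteq> quadrant y x \<and> length xs = k"
  then show "k \<le> depth S y x"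
    unfolding depth_def by (intro Max_ge finite_chain_lengths) auto
qed

lemma length_le_depth:
  "chain_in S xs \<Longrightarrow> set xs \<subseteq> quadrant y x \<Longrightarrow> length xs \<le> depth S y x"
  using le_depth_iff by blast

lemma depth_chain:
  obtains xs where "chain_in S xs" "set xs \<subseteq> quadrant y x" "length xs = depth S y x"
  using le_depth_iff by blast

lemma depth_le_size: "depth S y x \<le> size S"
proof -
  obtain xs where "chain_in S xs" "length xs = depth S y x"
    by (rule depth_chain)
  then show ?thesis
    by (metis length_chain_le le_trans set_mset_mset size_mset card_length ex_mset)
qed

lemma depth_mono:
  assumes "y' \<le> y" "x \<le> x'"
  shows "depth S y x \<le> depth S y' x'"
proof -
  obtain xs where "chain_in S xs" "set xs \<subseteq> quadrant y x" "length xs = depth S y x"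
    by (rule depth_chain)
  then show ?thesis
    using assms by (intro length_le_depth[of S xs, THEN le_trans[rotated]]) (auto simp: quadrant_def)
qed

text \<open>Along a chain rows fall and columns rise, so the last member is the one closest to the
  corner and controls all the others.\<close>

lemma chain_snoc_subset_quadrant:
  assumes "chain_in S (xs @ [p])" "p \<in> quadrant y x"
  shows "set xs \<subseteq> quadrant (fst p) (snd p - 1)" "set (xs @ [p]) \<subseteq> quadrant y x"
  using assms by (fastforce simp: chain_in_append quadrant_def gt_def)+

text \<open>Only the last member of a chain can meet row \<open>Suc y\<close> or column
  \<open>Suc x\<close>; without it the chain fits into the smaller quadrant.\<close>

lemma depth_step: "depth S y (Suc x) \<le> depth S (Suc y) x + 1"
proof -
  obtain xs where xs: "chain_in S xs" "set xs \<subseteq> quadrant y (Suc x)" "length xs = depth S y (Suc x)"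
    by (rule depth_chain)
  show ?thesis
  proof (cases xs rule: rev_cases)
    case Nil
    then show ?thesis using xs by simp
  next
    case (snoc ys p)
    then have "set ys \<subseteq> quadrant (fst p) (snd p - 1)" "p \<in> quadrant y (Suc x)" "chain_in S ys"
      using xs chain_snoc_subset_quadrant[of S ys p] by (auto simp: chain_in_append)
    then have "set ys \<subseteq> quadrant (Suc y) x"
      by (fastforce simp: quadrant_def)
    then have "length ys \<le> depth S (Suc y) x"
      using \<open>chain_in S ys\<close> by (rule length_le_depth[rotated])
    then show ?thesis using xs snoc by simp
  qed
qed

lemma depth_member:
  assumes "(Suc y, Suc x) \<in># S"
  shows "depth S y (Suc x) = depth S (Suc y) x + 1"
proof (rule antisym[OF depth_step])
  obtain xs where xs: "chain_in S xs" "set xs \<subseteq> quadrant (Suc y) x" "length xs = depth S (Suc y) x"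
    by (rule depth_chain)
  have "chain_in S (xs @ [(Suc y, Suc x)])"
    using xs assms by (auto simp: chain_in_def sorted_wrt_append gt_def quadrant_def)
  moreover have "set (xs @ [(Suc y, Suc x)]) \<subseteq> quadrant y (Suc x)"
    using xs by (auto simp: quadrant_def)
  ultimately show "depth S (Suc y) x + 1 \<le> depth S y (Suc x)"
    using length_le_depth xs(3) by fastforce
qed

text \<open>The last member of a longest chain is not the corner pair, so it misses row
  \<open>Suc y\<close> or column \<open>Suc x\<close>, and the whole chain misses it too.\<close>

lemma depth_nonmember:
  assumes "(Suc y, Suc x) \<notin># S"
  shows "depth S y (Suc x) = max (depth S (Suc y) (Suc x)) (depth S y x)"
proof (rule antisym)
  obtain xs where xs: "chain_in S xs" "set xs \<subseteq> quadrant y (Suc x)" "length xs = depth S y (Suc x)"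
    by (rule depth_chain)
  show "depth S y (Suc x) \<le> max (depth S (Suc y) (Suc x)) (depth S y x)"
  proof (cases xs rule: rev_cases)
    case Nil
    then show ?thesis using xs by simp
  next
    case (snoc ys p)
    have "p \<in># S" "p \<in> quadrant y (Suc x)"
      using xs snoc by (auto simp: chain_in_def)
    then have "p \<in> quadrant (Suc y) (Suc x) \<or> p \<in> quadrant y x"
      using assms by (cases p) (auto simp: quadrant_def le_Suc_eq intro: Suc_lessI)
    then have "set xs \<subseteq> quadrant (Suc y) (Suc x) \<or> set xs \<subseteq> quadrant y x"
      using chain_snoc_subset_quadrant(2) xs(1) snoc by blast
    then show ?thesis
      using length_le_depth[OF xs(1)] xs(3) by fastforce
  qed
qed (simp add: depth_mono)

text \<open>The forward local rule: \<open>S\<close> gives the outer corner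
  \<open>(y, Suc x)\<close> of a cell from the other three.\<close>

lemma depth_rec:
  "depth S y (Suc x) =
     (if (Suc y, Suc x) \<in># S then depth S (Suc y) x + 1
      else max (depth S (Suc y) (Suc x)) (depth S y x))"
  by (simp add: depth_member depth_nonmember)

section \<open>Boundary values, empty rows and empty columns\<close>

lemma depth_eq_0:
  assumes "\<And>p. p \<in># S \<Longrightarrow> p \<notin> quadrant y x"
  shows "depth S y x = 0"
proof -
  obtain xs where xs: "chain_in S xs" "set xs \<subseteq> quadrant y x" "length xs = depth S y x"
    by (rule depth_chain)
  then have "xs = []"
    using assms by (cases xs) (auto simp: chain_in_def)
  then show ?thesis using xs by simp
qed

lemma depth_0_right: "monomial d v S \<Longrightarrow> v \<subseteq> {1..2*d} \<Longrightarrow> depth S y 0 = 0"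
  by (rule depth_eq_0) (auto simp: monomial_def roots_def quadrant_def)

lemma depth_top: "monomial d v S \<Longrightarrow> 2 * d \<le> y \<Longrightarrow> depth S y x = 0"
  by (rule depth_eq_0) (auto simp: monomial_def roots_def quadrant_def)

lemma qcount_0_right: "monomial d v S \<Longrightarrow> v \<subseteq> {1..2*d} \<Longrightarrow> qcount S y 0 = 0"
  by (auto simp: qcount_def monomial_def roots_def quadrant_def filter_mset_eq_conv)

lemma qcount_top: "monomial d v S \<Longrightarrow> 2 * d \<le> y \<Longrightarrow> qcount S y x = 0"
  by (auto simp: qcount_def monomial_def roots_def quadrant_def filter_mset_eq_conv)

text \<open>Inclusion-exclusion over the four corners of a cell, with all terms kept positive to
  avoid subtraction on \<open>nat\<close>.\<close>

lemma qcount_rec: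
  "qcount S y (Suc x) + qcount S (Suc y) x =
     count S (Suc y, Suc x) + qcount S (Suc y) (Suc x) + qcount S y x"
proof (induction S)
  case (add p S)
  then show ?case
    by (cases p) (auto simp: qcount_def quadrant_def)
qed (simp add: qcount_def)

lemma depth_row_empty:
  assumes "\<And>c. (Suc y, c) \<notin># S"
  shows "depth S (Suc y) x = depth S y x"
proof -
  obtain xs where xs: "chain_in S xs" "set xs \<subseteq> quadrant y x" "length xs = depth S y x"
    by (rule depth_chain)
  have "set xs \<subseteq> quadrant (Suc y) x"
  proof
    fix p assume "p \<in> set xs"
    then have "p \<in># S" "p \<in> quadrant y x"
      using xs by (auto simp: chain_in_def)
    then show "p \<in> quadrant (Suc y) x"
      using assms by (cases p) (auto simp: quadrant_def intro!: Suc_lessI)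
  qed
  then show ?thesis
    using length_le_depth[OF xs(1)] xs(3) depth_mono[of y "Suc y" x x S] by fastforce
qed

lemma depth_column_empty:
  assumes "\<And>r. (r, Suc x) \<notin># S"
  shows "depth S y (Suc x) = depth S y x"
proof -
  obtain xs where xs: "chain_in S xs" "set xs \<subseteq> quadrant y (Suc x)" "length xs = depth S y (Suc x)"
    by (rule depth_chain)
  have "set xs \<subseteq> quadrant y x"
  proof
    fix p assume "p \<in> set xs"
    then have "p \<in># S" "p \<in> quadrant y (Suc x)"
      using xs by (auto simp: chain_in_def)
    then show "p \<in> quadrant y x"
      using assms by (cases p) (auto simp: quadrant_def le_Suc_eq)
  qed
  then show ?thesis
    using length_le_depth[OF xs(1)] xs(3) depth_mono[of y y x "Suc x" S] by fastforce
qed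

section \<open>Layers\<close>

text \<open>A chain in the corner quadrant of \<open>p\<close> need not end in \<open>p\<close>, but
  its last member can be replaced by \<open>p\<close>: the earlier members lie strictly beyond that
  last member and hence beyond \<open>p\<close>.\<close>

lemma deep_iff_depth:
  assumes "p \<in># S" "fst p > 0"
  shows "deep S j p \<longleftrightarrow> 1 \<le> j \<and> j \<le> depth S (fst p - 1) (snd p)"
proof
  assume "deep S j p"
  then obtain xs where xs: "chain_in S (xs @ [p])" "length (xs @ [p]) = j"
    unfolding deep_def by (metis append_butlast_last_id)
  then have "length (xs @ [p]) \<le> depth S (fst p - 1) (snd p)"
    using assms by (intro length_le_depth chain_snoc_subset_quadrant(2)) (auto simp: quadrant_def)
  then show "1 \<le> j \<and> j \<le> depth S (fst p - 1) (snd p)"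
    using xs by auto
next
  assume j: "1 \<le> j \<and> j \<le> depth S (fst p - 1) (snd p)"
  show "deep S j p"
  proof (cases "j = 1")
    case True
    then show ?thesis
      unfolding deep_def using assms by (intro exI[of _ "[p]"]) (auto simp: chain_in_def)
  next
    case False
    obtain ys where ys: "chain_in S ys" "set ys \<subseteq> quadrant (fst p - 1) (snd p)" "length ys = j"
      using j le_depth_iff by blast
    then obtain zs q where zs: "ys = zs @ [q]"
      using j by (cases ys rule: rev_cases) auto
    have "q \<in> quadrant (fst p - 1) (snd p)"
      using ys zs by auto
    \<comment> \<open>Since j is not 1, \<open>zs\<close> is nonempty. This gives
      \<open>0 < snd p\<close>, so that \<open>snd p - 1\<close> is a true predecessor.\<close>
    then have "set zs \<subseteq> quadrant (fst p) (snd p - 1) \<and> 0 < snd p"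
      using ys zs j False by (fastforce simp: quadrant_def chain_in_append gt_def neq_Nil_conv Suc_le_eq)
    then have "chain_in S (zs @ [p])"
      using ys zs assms
      by (auto simp: sorted_wrt_append gt_def quadrant_def chain_in_def subset_iff) fastforce?
    then show ?thesis
      unfolding deep_def using ys zs by (intro exI[of _ "zs @ [p]"]) auto
  qed
qed

lemma layer_eq:
  assumes "\<And>p. p \<in># S \<Longrightarrow> fst p > 0" "1 \<le> j"
  shows "layer S j = filter_mset (\<lambda>p. depth S (fst p - 1) (snd p) = j) S"
  unfolding layer_def using assms by (intro filter_mset_cong) (auto simp: deep_iff_depth)

text \<open>The end \<open>q\<close> of a chain of length j has depth at least j. If it is more, the
  quadrant strictly beyond \<open>q\<close> still has depth at least j, because the diagonal step
  costs at most one; its column bound is smaller, so the search terminates.\<close>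

lemma member_quadrant_at_depth:
  assumes pos: "\<And>p. p \<in># S \<Longrightarrow> fst p > 0 \<and> snd p > 0" and j: "1 \<le> j"
  shows "j \<le> depth S y x \<Longrightarrow> \<exists>p\<in>#S. p \<in> quadrant y x \<and> depth S (fst p - 1) (snd p) = j"
proof (induction x arbitrary: y rule: less_induct)
  case (less x)
  then obtain xs where xs: "chain_in S xs" "set xs \<subseteq> quadrant y x" "length xs = j"
    using le_depth_iff by blast
  then obtain ys q where ys: "xs = ys @ [q]"
    using j by (cases xs rule: rev_cases) auto
  have q: "q \<in># S" "q \<in> quadrant y x"
    using xs ys by (auto simp: chain_in_def)
  have "deep S j q"
    using xs ys by (auto simp: deep_def)
  then have le: "j \<le> depth S (fst q - 1) (snd q)"
    using q pos by (simp add: deep_iff_depth)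
  show ?case
  proof (cases "j = depth S (fst q - 1) (snd q)")
    case True
    then show ?thesis using q by auto
  next
    case False
    have "depth S (fst q - 1) (snd q) \<le> depth S (fst q) (snd q - 1) + 1"
      using depth_step[of S "fst q - 1" "snd q - 1"] pos[OF q(1)] by simp
    then have "j \<le> depth S (fst q) (snd q - 1)"
      using le False by linarith
    moreover have "snd q - 1 < x"
      using pos[OF q(1)] q(2) by (auto simp: quadrant_def)
    ultimately obtain p where "p \<in># S" "p \<in> quadrant (fst q) (snd q - 1)"
        "depth S (fst p - 1) (snd p) = j"
      using less.IH by blast
    moreover have "quadrant (fst q) (snd q - 1) \<subseteq> quadrant y x"
      using q(2) by (auto simp: quadrant_def)
    ultimately show ?thesis by blast
  qed
qed

text \<open>The corner quadrant of a member lies inside every quadrant containing it, so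
  monotonicity bounds its layer number; conversely every level up to the depth is attained.\<close>

lemma layer_meets_quadrant_iff:
  assumes pos: "\<And>p. p \<in># S \<Longrightarrow> fst p > 0 \<and> snd p > 0" and j: "1 \<le> j"
  shows "(\<exists>p\<in>#layer S j. p \<in> quadrant y x) \<longleftrightarrow> j \<le> depth S y x"
proof -
  have in_layer: "p \<in># layer S j \<longleftrightarrow> p \<in># S \<and> depth S (fst p - 1) (snd p) = j" for p
    using layer_eq[of S j] pos j by auto
  have "j \<le> depth S y x" if "p \<in> quadrant y x" "p \<in># layer S j" for p
    using depth_mono[of y "fst p - 1" "snd p" x S] that in_layer by (auto simp: quadrant_def)
  moreover have "\<exists>p\<in>#S. p \<in> quadrant y x \<and> depth S (fst p - 1) (snd p) = j" if "j \<le> depth S y x"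
    using pos j that by (rule member_quadrant_at_depth)
  ultimately show ?thesis
    using in_layer by blast
qed

lemma sum_layers:
  assumes pos: "\<And>p. p \<in># S \<Longrightarrow> fst p > 0"
  shows "(\<Sum>j = 1..size S. layer S j) = S"
proof (rule multiset_eqI)
  fix p
  have "count (\<Sum>j = 1..size S. layer S j) p
      = (\<Sum>j = 1..size S. if depth S (fst p - 1) (snd p) = j then count S p else 0)"
    unfolding count_sum using pos by (intro sum.cong) (auto simp: layer_eq)
  also have "\<dots> = (if depth S (fst p - 1) (snd p) \<in> {1..size S} then count S p else 0)"
    by (simp add: sum.delta)
  also have "\<dots> = count S p"
  proof (cases "p \<in># S")
    case True
    then have "deep S 1 p"
      unfolding deep_def by (intro exI[of _ "[p]"]) (auto simp: chain_in_def)
    then show ?thesis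
      using True pos depth_le_size[of S] by (auto simp: deep_iff_depth)
  qed (simp add: not_in_iff)
  finally show "count (\<Sum>j = 1..size S. layer S j) p = count S p" .
qed

lemma arrangement_layer:
  "mset (arrangement (layer S j)) = layer S j \<and>
   sorted (map fst (arrangement (layer S j))) \<and> sorted (map snd (arrangement (layer S j)))"
  unfolding arrangement_def
  by (rule theI'[OF arrangement_ex1]) (rule layer_incomparable)

lemma set_arrangement_layer: "set (arrangement (layer S j)) = set_mset (layer S j)"
  by (metis arrangement_layer set_mset_mset)

text \<open>Summed over all layers the last term becomes the depth; this is how the blocks disappear.\<close>

lemma filter_quadrant_shift:
  assumes "sorted (map fst xs)" "sorted (map snd xs)" "x \<le> y"
  shows "size (filter_mset (\<lambda>p. p \<in> quadrant y x) (mset xs)) =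
    size (filter_mset (\<lambda>p. p \<in> quadrant y x)
      (filter_mset (\<lambda>p. fst p > snd p) (mset (zip (map fst xs) (map snd (tl xs))))))
    + of_bool (\<exists>p\<in>set xs. p \<in> quadrant y x)"
  using assms
proof (induction xs rule: induct_list012)
  case (3 p q xs)
  have IH: "size (filter_mset (\<lambda>p. p \<in> quadrant y x) (mset (q # xs))) =
    size (filter_mset (\<lambda>p. p \<in> quadrant y x)
      (filter_mset (\<lambda>p. fst p > snd p) (mset (zip (map fst (q # xs)) (map snd xs)))))
    + of_bool (\<exists>p\<in>set (q # xs). p \<in> quadrant y x)"
    using 3 by simp
  have pq: "fst p \<le> fst q" "snd p \<le> snd q"
    and q: "\<And>p'. p' \<in> set (q # xs) \<Longrightarrow> snd q \<le> snd p'"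
    using 3(3,4) by auto
  show ?case
  proof (cases "p \<in> quadrant y x")
    case True
    show ?thesis
    proof (cases "snd q \<le> x")
      case True
      \<comment> \<open>Here x <= y enters: \<open>snd q <= x <= y < fst p\<close>, so the shifted
        pair survives the filter and accounts for \<open>p\<close>.\<close>
      then have "q \<in> quadrant y x" "(fst p, snd q) \<in> quadrant y x" "snd q < fst p"
        using \<open>p \<in> quadrant y x\<close> pq \<open>x \<le> y\<close> by (auto simp: quadrant_def)
      then show ?thesis
        using IH True \<open>p \<in> quadrant y x\<close> by simp
    next
      \<comment> \<open>By sortedness all later members are outside as well. So \<open>p\<close> is
        the last member inside, the one without a partner, and it is counted by the
        \<open>of_bool\<close> term.\<close>
      case False
      then have "\<forall>p'\<in>set (q # xs). p' \<notin> quadrant y x"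
        using q by (fastforce simp: quadrant_def)
      moreover have "(fst p, snd q) \<notin> quadrant y x"
        using False by (simp add: quadrant_def)
      ultimately show ?thesis
        using IH \<open>p \<in> quadrant y x\<close> by simp
    qed
  next
    case False
    then have "(fst p, snd q) \<notin> quadrant y x"
      using pq by (auto simp: quadrant_def)
    then show ?thesis
      using IH False by simp
  qed
qed (auto simp: quadrant_def)

section \<open>Blocks as intervals of positions\<close>

text \<open>The links join consecutive positions only, so they form a disjoint union of paths, where
  two positions are connected exactly if no link between them is missing.\<close>

lemma block_relation_iff:
  "(i, j) \<in> (related xs \<union> (related xs)\<inverse>)\<^sup>* \<longleftrightarrow>
     (\<forall>k. min i j \<le> k \<longrightarrow> k < max i j \<longrightarrow> (k, Suc k) \<in> related xs)"
proof
  assume "(i, j) \<in> (related xs \<union> (related xs)\<inverse>)\<^sup>*"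
  then show "\<forall>k. min i j \<le> k \<longrightarrow> k < max i j \<longrightarrow> (k, Suc k) \<in> related xs"
  proof (induction rule: rtrancl_induct)
    case (step j l)
    then have jl: "l = Suc j \<or> j = Suc l" and e: "(min j l, Suc (min j l)) \<in> related xs"
      by (auto simp: related_def)
    show ?case
    proof (intro allI impI)
      fix k assume "min i l \<le> k" "k < max i l"
      then have "k = min j l \<or> (min i j \<le> k \<and> k < max i j)"
        using jl by linarith
      then show "(k, Suc k) \<in> related xs"
        using e step.IH by blast
    qed
  qed auto
next
  have up: "(a, a + n) \<in> (related xs)\<^sup>*"
    if "\<forall>k. a \<le> k \<longrightarrow> k < a + n \<longrightarrow> (k, Suc k) \<in> related xs" for a n
    using that
  proof (induction n)
    case (Suc n)
    then have "(a, a + n) \<in> (related xs)\<^sup>*" "(a + n, Suc (a + n)) \<in> related xs"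
      by simp_all
    then show ?case by (simp add: rtrancl.rtrancl_into_rtrancl)
  qed simp
  assume *: "\<forall>k. min i j \<le> k \<longrightarrow> k < max i j \<longrightarrow> (k, Suc k) \<in> related xs"
  then have "(min i j, max i j) \<in> (related xs)\<^sup>*"
    using up[of "min i j" "max i j - min i j"] by simp
  then have "(i, j) \<in> (related xs)\<^sup>* \<or> (j, i) \<in> (related xs)\<^sup>*"
    by (auto simp: min_def max_def split: if_splits)
  moreover have "(related xs)\<^sup>* \<subseteq> (related xs \<union> (related xs)\<inverse>)\<^sup>*"
    by (rule rtrancl_mono) simp
  moreover have "sym ((related xs \<union> (related xs)\<inverse>)\<^sup>*)"
    by (intro sym_rtrancl sym_Un_converse)
  ultimately show "(i, j) \<in> (related xs \<union> (related xs)\<inverse>)\<^sup>*"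
    by (metis (no_types) subsetD symD)
qed

lemma equiv_block_relation: "equiv UNIV ((related xs \<union> (related xs)\<inverse>)\<^sup>*)"
  by (intro equivI refl_rtrancl sym_rtrancl sym_Un_converse trans_rtrancl) simp

lemma block_positions_disjoint:
  assumes "A \<in> block_positions xs" "B \<in> block_positions xs" "i \<in> A" "i \<in> B"
  shows "A = B"
proof -
  have "A \<in> UNIV // (related xs \<union> (related xs)\<inverse>)\<^sup>*" "B \<in> UNIV // (related xs \<union> (related xs)\<inverse>)\<^sup>*"
    using assms by (auto simp: block_positions_def quotient_def)
  then show ?thesis
    using quotient_disj[OF equiv_block_relation] assms(3,4) by blast
qed

lemma related_bound: "(i, j) \<in> related xs \<Longrightarrow> j = Suc i \<and> Suc i < length xs"
  by (auto simp: related_def)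

text \<open>The form in which blocks are used: the links inside give the crossing arguments of
  \<open>block_starts\<close> and \<open>block_ends\<close>, the missing links at the two ends give
  their converses.\<close>

lemma block_positionsE:
  assumes "A \<in> block_positions xs"
  obtains l h where "A = {l..<Suc h}" "l \<le> h" "h < length xs"
    "\<And>k. l \<le> k \<Longrightarrow> k < h \<Longrightarrow> (k, Suc k) \<in> related xs"
    "l = 0 \<or> (l - 1, l) \<notin> related xs" "(h, Suc h) \<notin> related xs"
proof -
  let ?R = "(related xs \<union> (related xs)\<inverse>)\<^sup>*"
  obtain i where i: "i < length xs" "A = ?R `` {i}"
    using assms by (auto simp: block_positions_def quotient_def)
  \<comment> \<open>The relation lives on all natural numbers, so its classes have to be confined to
    the list; a class can only leave \<open>i\<close> upwards through a link, and links stay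
    inside.\<close>
  have bound: "j < length xs" if "j \<in> A" for j
  proof (cases "j \<le> i")
    case False
    then have "min i j \<le> j - 1" "j - 1 < max i j"
      by auto
    moreover have "(i, j) \<in> ?R"
      using that i(2) by simp
    ultimately have "(j - 1, Suc (j - 1)) \<in> related xs"
      unfolding block_relation_iff by blast
    then show ?thesis
      using False related_bound[of "j - 1" "Suc (j - 1)" xs] by simp
  qed (use i in simp)
  have fin: "finite A"
    by (rule finite_subset[of _ "{..<length xs}"]) (use bound in auto)
  have ne: "A \<noteq> {}"
    using i by auto
  have A_iff: "j \<in> A \<longleftrightarrow> (k, j) \<in> ?R" if "k \<in> A" for j k
  proof -
    have "(i, k) \<in> ?R"
      using that i(2) by simp
    then have "(i, j) \<in> ?R \<longleftrightarrow> (k, j) \<in> ?R"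
      using equiv_block_relation[of xs] by (meson equivE symD transD)
    then show ?thesis
      using i(2) by simp
  qed
  define l h where "l = Min A" and "h = Max A"
  have lh: "l \<in> A" "h \<in> A" "l \<le> h" and sub: "A \<subseteq> {l..<Suc h}"
    using fin ne by (auto simp: l_def h_def less_Suc_eq_le)
  have rel: "(k, Suc k) \<in> related xs" if "l \<le> k" "k < h" for k
    using A_iff[OF lh(1), of h] lh that by (simp add: block_relation_iff)
  have "k \<in> A" if "l \<le> k" "k \<le> h" for k
    using A_iff[OF lh(1), of k] rel that by (auto simp: block_relation_iff)
  then have "A = {l..<Suc h}"
    using sub by auto
  moreover have "(h, Suc h) \<notin> related xs"
  proof
    assume "(h, Suc h) \<in> related xs"
    then have "Suc h \<in> A"
      using A_iff[OF lh(2), of "Suc h"] by (auto simp: block_relation_iff less_Suc_eq_le)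
    then show False using sub by auto
  qed
  moreover have "l = 0 \<or> (l - 1, l) \<notin> related xs"
  proof (rule ccontr)
    assume *: "\<not> (l = 0 \<or> (l - 1, l) \<notin> related xs)"
    have "(l, l - 1) \<in> ?R"
      unfolding block_relation_iff
    proof (intro allI impI)
      fix k assume "min l (l - 1) \<le> k" "k < max l (l - 1)"
      then have "k = l - 1" "Suc k = l"
        by auto
      then show "(k, Suc k) \<in> related xs"
        using * by simp
    qed
    then have "l - 1 \<in> A"
      using A_iff[OF lh(1)] by blast
    then show False using subsetD[OF sub, of "l - 1"] * by auto
  qed
  ultimately show ?thesis
    using that lh bound rel by blast
qed

lemma block_positions_cover:
  assumes "i < length xs"
  obtains A where "A \<in> block_positions xs" "i \<in> A"
  using assms by (auto simp: block_positions_def quotient_def)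

lemma finite_block_positions: "finite (block_positions xs)"
  by (simp add: block_positions_def quotient_def)

lemma Union_block_positions: "\<Union> (block_positions xs) = {..<length xs}"
proof
  show "\<Union> (block_positions xs) \<subseteq> {..<length xs}"
    by (fastforce elim: block_positionsE)
  show "{..<length xs} \<subseteq> \<Union> (block_positions xs)"
    by (auto elim: block_positions_cover)
qed

lemma nths_interval:
  assumes "h < length xs"
  shows "nths xs {l..<Suc h} = map ((!) xs) [l..<Suc h]"
proof -
  have "zip xs [0..<length xs] = map (\<lambda>i. (xs ! i, i)) [0..<length xs]"
    by (rule nth_equalityI) auto
  then have "nths xs {l..<Suc h} = map ((!) xs) (filter (\<lambda>i. i \<in> {l..<Suc h}) [0..<length xs])"
    by (simp add: nths_def filter_map comp_def)
  also have "filter (\<lambda>i. i \<in> {l..<Suc h}) [0..<length xs] = [l..<Suc h]"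
    using assms by (intro sorted_distinct_set_unique) (auto intro: sorted_wrt_filter simp del: upt_Suc)
  finally show ?thesis .
qed

lemma mset_map_upt: "mset (map g [l..<h]) = (\<Sum>i\<in>{l..<h}. {#g i#})"
proof -
  have "mset (map g is) = sum_list (map (\<lambda>i. {#g i#}) is)" for "is"
    by (induction "is") auto
  from this[of "[l..<h]"] show ?thesis
    by (simp only: interv_sum_list_conv_sum_set_nat set_upt)
qed

lemma filter_mset_sum: "filter_mset P (sum f I) = (\<Sum>i\<in>I. filter_mset P (f i))"
  by (induction I rule: infinite_finite_induct) auto

text \<open>Consecutive positions are in the same block exactly if they are linked, that is, if the
  row of the first exceeds the column of the second. Hence filtering the shift of the whole list has
  the same effect as shifting every block separately.\<close>

lemma sum_block_prime:
  "(\<Sum>A\<in>block_positions xs. block_prime (nths xs A)) =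
    filter_mset (\<lambda>p. fst p > snd p) (mset (zip (map fst xs) (map snd (tl xs))))"
proof -
  define g where "g = (\<lambda>i. (fst (xs ! i), snd (xs ! Suc i)))"
  define f where "f = (\<lambda>i. if (i, Suc i) \<in> related xs then {#g i#} else {#})"
  have "block_prime (nths xs A) = sum f A" if A: "A \<in> block_positions xs" for A
  proof -
    from A obtain l h where lh: "A = {l..<Suc h}" "l \<le> h" "h < length xs"
        "\<And>k. l \<le> k \<Longrightarrow> k < h \<Longrightarrow> (k, Suc k) \<in> related xs" "(h, Suc h) \<notin> related xs"
      by (rule block_positionsE) blast
    have "zip (map fst (butlast (nths xs A))) (map snd (tl (nths xs A))) = map g [l..<h]"
      unfolding lh(1) nths_interval[OF lh(3)]
      by (rule nth_equalityI) (use lh in \<open>auto simp: g_def nth_butlast nth_tl simp del: upt_Suc\<close>)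
    then have "block_prime (nths xs A) = (\<Sum>i\<in>{l..<h}. {#g i#})"
      by (simp only: block_prime_def mset_map_upt)
    also have "\<dots> = sum f {l..<h}"
      using lh by (intro sum.cong) (auto simp: f_def)
    \<comment> \<open>The last position \<open>h\<close> of the block adds nothing, since its link
      to \<open>Suc h\<close> is missing.\<close>
    also have "\<dots> = sum f A"
      using lh by (simp add: f_def)
    finally show ?thesis .
  qed
  then have "(\<Sum>A\<in>block_positions xs. block_prime (nths xs A)) = (\<Sum>A\<in>block_positions xs. sum f A)"
    by (intro sum.cong) auto
  also have "\<dots> = sum f (\<Union> (block_positions xs))"
    by (subst sum.Union_disjoint) (auto dest: block_positions_disjoint elim: block_positionsE)
  also have "\<dots> = sum f {..<length xs}"
    by (simp add: Union_block_positions)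
  also have "\<dots> = sum f {0..<length xs - 1}"
    by (rule sum.mono_neutral_right) (auto simp: f_def related_def)
  also have "\<dots> = (\<Sum>i\<in>{0..<length xs - 1}. filter_mset (\<lambda>p. fst p > snd p) {#g i#})"
    by (intro sum.cong) (auto simp: f_def related_def g_def)
  also have "\<dots> = filter_mset (\<lambda>p. fst p > snd p) (\<Sum>i\<in>{0..<length xs - 1}. {#g i#})"
    by (simp only: filter_mset_sum)
  also have "(\<Sum>i\<in>{0..<length xs - 1}. {#g i#}) = mset (zip (map fst xs) (map snd (tl xs)))"
  proof -
    have "map g [0..<length xs - 1] = zip (map fst xs) (map snd (tl xs))"
      by (rule nth_equalityI) (auto simp: g_def nth_tl)
    with mset_map_upt[of g 0 "length xs - 1"] show ?thesis
      by (simp only:)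
  qed
  finally show ?thesis .
qed

text \<open>A link leading from a column below \<open>z\<close> to a column at least
  \<open>z\<close> has its first member in \<open>quadrant z (z - 1)\<close>. So if that quadrant is
  avoided, a member with column \<open>z\<close> cannot be linked back to a smaller column; if a
  block does start at \<open>z\<close>, all earlier rows are at most \<open>z\<close>.\<close>

lemma block_starts:
  assumes "sorted (map fst xs)" "sorted (map snd xs)" "\<And>p. p \<in> set xs \<Longrightarrow> snd p < fst p"
    and "z \<notin> fst ` set xs" "0 < z"
  shows "z \<in> (\<lambda>A. snd (block_w (nths xs A))) ` block_positions xs \<longleftrightarrow>
    (\<exists>p\<in>set xs. p \<in> quadrant z z) \<and> \<not> (\<exists>p\<in>set xs. p \<in> quadrant z (z - 1))"
proof -
  have fst_mono: "fst (xs ! i) \<le> fst (xs ! j)" if "i \<le> j" "j < length xs" for i j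
    using sorted_nth_mono[OF assms(1) that(1)] that by simp
  have snd_mono: "snd (xs ! i) \<le> snd (xs ! j)" if "i \<le> j" "j < length xs" for i j
    using sorted_nth_mono[OF assms(2) that(1)] that by simp
  show ?thesis
  proof
    assume "z \<in> (\<lambda>A. snd (block_w (nths xs A))) ` block_positions xs"
    then obtain A where A: "A \<in> block_positions xs" "z = snd (block_w (nths xs A))"
      by auto
    then obtain l h where lh: "A = {l..<Suc h}" "l \<le> h" "h < length xs"
        "l = 0 \<or> (l - 1, l) \<notin> related xs"
      by (elim block_positionsE) blast
    have z: "z = snd (xs ! l)"
      using A lh by (simp add: block_w_def nths_interval hd_map del: upt_Suc)
    have l: "xs ! l \<in> set xs"
      using lh by simp
    then have "xs ! l \<in> quadrant z z"
      using assms(3)[OF l] z by (simp add: quadrant_def)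
    moreover have "p \<notin> quadrant z (z - 1)" if mem: "p \<in> set xs" for p
    proof
      assume p: "p \<in> quadrant z (z - 1)"
      obtain k where k: "k < length xs" "p = xs ! k"
        using mem unfolding in_set_conv_nth by blast
      have "k < l"
      proof (rule ccontr)
        assume "\<not> k < l"
        then have "z \<le> snd p"
          using snd_mono[of l k] k z by simp
        then show False
          using p assms(5) by (auto simp: quadrant_def)
      qed
      then have "fst (xs ! k) \<le> fst (xs ! (l - 1))" "fst (xs ! (l - 1)) \<le> snd (xs ! l)"
        using lh fst_mono[of k "l - 1"] by (auto simp: related_def)
      then show False
        using p k z by (auto simp: quadrant_def)
    qed
    ultimately show "(\<exists>p\<in>set xs. p \<in> quadrant z z) \<and> \<not> (\<exists>p\<in>set xs. p \<in> quadrant z (z - 1))"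
      using l by blast
  next
    assume *: "(\<exists>p\<in>set xs. p \<in> quadrant z z) \<and> \<not> (\<exists>p\<in>set xs. p \<in> quadrant z (z - 1))"
    then obtain p where p: "p \<in> set xs" "p \<in> quadrant z z" by blast
    then obtain i where i: "i < length xs" "p = xs ! i"
      unfolding in_set_conv_nth by blast
    have "snd (xs ! i) = z"
      using p i * by (force simp: quadrant_def)
    obtain A where A: "A \<in> block_positions xs" "i \<in> A"
      using i by (auto elim: block_positions_cover)
    then obtain l h where lh: "A = {l..<Suc h}" "l \<le> h" "h < length xs"
        "\<And>k. l \<le> k \<Longrightarrow> k < h \<Longrightarrow> (k, Suc k) \<in> related xs"
      by (elim block_positionsE) blast
    have "snd (xs ! l) = z"
    proof (rule ccontr)
      assume ne: "snd (xs ! l) \<noteq> z"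
      have le: "snd (xs ! l) < z"
        using ne snd_mono[of l i] lh A i \<open>snd (xs ! i) = z\<close> by auto
      \<comment> \<open>The last position before \<open>i\<close> with column below
        \<open>z\<close>: its link to the successor crosses \<open>z\<close>.\<close>
      define k where "k = Max {k \<in> {l..i}. snd (xs ! k) < z}"
      have "l \<in> {k \<in> {l..i}. snd (xs ! k) < z}"
        using le lh A by auto
      then have k: "k \<in> {k \<in> {l..i}. snd (xs ! k) < z}"
        unfolding k_def by (intro Max_in) auto
      then have "k < i"
        using \<open>snd (xs ! i) = z\<close> by (cases "k = i") auto
      have "Suc k \<notin> {k \<in> {l..i}. snd (xs ! k) < z}"
        using Max_ge[of "{k \<in> {l..i}. snd (xs ! k) < z}" "Suc k"] unfolding k_def[symmetric] by auto
      then have "z \<le> snd (xs ! Suc k)"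
        using k \<open>k < i\<close> by auto
      moreover have "(k, Suc k) \<in> related xs"
        using lh A k \<open>k < i\<close> by auto
      ultimately have "z < fst (xs ! k)"
        by (auto simp: related_def)
      then have "xs ! k \<in> quadrant z (z - 1)" "xs ! k \<in> set xs"
        using k \<open>k < i\<close> i by (auto simp: quadrant_def)
      then show False using * by blast
    qed
    then have "z = snd (block_w (nths xs A))"
      using lh by (simp add: block_w_def nths_interval hd_map del: upt_Suc)
    then show "z \<in> (\<lambda>A. snd (block_w (nths xs A))) ` block_positions xs"
      using A by blast
  qed
qed

text \<open>The crossing argument again, now with rows: a link leading from a row at most
  \<open>z\<close> to a row above \<open>z\<close> has its second member in
  \<open>quadrant z (z - 1)\<close>.\<close>

lemma block_ends:
  assumes "sorted (map fst xs)" "sorted (map snd xs)" "\<And>p. p \<in> set xs \<Longrightarrow> snd p < fst p" "0 < z"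
  shows "z \<in> (\<lambda>A. fst (block_w (nths xs A))) ` block_positions xs \<longleftrightarrow>
    (\<exists>p\<in>set xs. p \<in> quadrant (z - 1) (z - 1)) \<and> \<not> (\<exists>p\<in>set xs. p \<in> quadrant z (z - 1))"
proof -
  have fst_mono: "fst (xs ! i) \<le> fst (xs ! j)" if "i \<le> j" "j < length xs" for i j
    using sorted_nth_mono[OF assms(1) that(1)] that by simp
  have snd_mono: "snd (xs ! i) \<le> snd (xs ! j)" if "i \<le> j" "j < length xs" for i j
    using sorted_nth_mono[OF assms(2) that(1)] that by simp
  show ?thesis
  proof
    assume "z \<in> (\<lambda>A. fst (block_w (nths xs A))) ` block_positions xs"
    then obtain A where A: "A \<in> block_positions xs" "z = fst (block_w (nths xs A))"
      by auto
    then obtain l h where lh: "A = {l..<Suc h}" "l \<le> h" "h < length xs" "(h, Suc h) \<notin> related xs"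
      by (elim block_positionsE) blast
    have z: "z = fst (xs ! h)"
      using A lh by (simp add: block_w_def nths_interval last_map del: upt_Suc)
    have h: "xs ! h \<in> set xs"
      using lh by simp
    then have "xs ! h \<in> quadrant (z - 1) (z - 1)"
      using assms(3)[OF h] z by (auto simp: quadrant_def)
    moreover have "p \<notin> quadrant z (z - 1)" if mem: "p \<in> set xs" for p
    proof
      assume p: "p \<in> quadrant z (z - 1)"
      obtain k where k: "k < length xs" "p = xs ! k"
        using mem unfolding in_set_conv_nth by blast
      have "h < k"
      proof (rule ccontr)
        assume "\<not> h < k"
        then have "fst p \<le> z"
          using fst_mono[of k h] k z lh by simp
        then show False
          using p by (auto simp: quadrant_def)
      qed
      then have "snd (xs ! Suc h) \<le> snd (xs ! k)" "fst (xs ! h) \<le> snd (xs ! Suc h)"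
        using lh k snd_mono[of "Suc h" k] by (auto simp: related_def)
      then show False
        using p k z assms(4) by (auto simp: quadrant_def)
    qed
    ultimately show "(\<exists>p\<in>set xs. p \<in> quadrant (z - 1) (z - 1)) \<and>
        \<not> (\<exists>p\<in>set xs. p \<in> quadrant z (z - 1))"
      using h by blast
  next
    assume *: "(\<exists>p\<in>set xs. p \<in> quadrant (z - 1) (z - 1)) \<and>
        \<not> (\<exists>p\<in>set xs. p \<in> quadrant z (z - 1))"
    then obtain p where p: "p \<in> set xs" "p \<in> quadrant (z - 1) (z - 1)" by blast
    then obtain i where i: "i < length xs" "p = xs ! i"
      unfolding in_set_conv_nth by blast
    have fst_i: "fst (xs ! i) = z"
      using p i * by (force simp: quadrant_def)
    obtain A where A: "A \<in> block_positions xs" "i \<in> A"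
      using i by (auto elim: block_positions_cover)
    then obtain l h where lh: "A = {l..<Suc h}" "l \<le> h" "h < length xs"
        "\<And>k. l \<le> k \<Longrightarrow> k < h \<Longrightarrow> (k, Suc k) \<in> related xs"
      by (elim block_positionsE) blast
    have "fst (xs ! h) = z"
    proof (rule ccontr)
      assume ne: "fst (xs ! h) \<noteq> z"
      have le: "z < fst (xs ! h)"
        using ne fst_mono[of i h] lh A i fst_i by auto
      define k where "k = Min {k \<in> {i..h}. z < fst (xs ! k)}"
      have "h \<in> {k \<in> {i..h}. z < fst (xs ! k)}"
        using le lh A by auto
      then have k: "k \<in> {k \<in> {i..h}. z < fst (xs ! k)}"
        unfolding k_def by (intro Min_in) auto
      then have "i < k"
        using fst_i by (cases "k = i") auto
      have "k - 1 \<notin> {k \<in> {i..h}. z < fst (xs ! k)}"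
        using Min_le[of "{k \<in> {i..h}. z < fst (xs ! k)}" "k - 1"] \<open>i < k\<close>
        unfolding k_def[symmetric] by auto
      then have "fst (xs ! (k - 1)) \<le> z"
        using k \<open>i < k\<close> by auto
      moreover have "(k - 1, Suc (k - 1)) \<in> related xs"
        using lh(1) A(2) k \<open>i < k\<close> by (intro lh(4)) auto
      ultimately have "snd (xs ! k) < z"
        using \<open>i < k\<close> by (auto simp: related_def)
      then have "xs ! k \<in> quadrant z (z - 1)" "xs ! k \<in> set xs"
        using k lh by (auto simp: quadrant_def)
      then show False using * by blast
    qed
    then have "z = fst (block_w (nths xs A))"
      using lh by (simp add: block_w_def nths_interval last_map del: upt_Suc)
    then show "z \<in> (\<lambda>A. fst (block_w (nths xs A))) ` block_positions xs"
      using A by blast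
  qed
qed

section \<open>The map \<open>\<pi>\<close> in terms of depths\<close>

text \<open>The equation \<open>KR_pi v S = (w, S')\<close> without blocks.\<close>

definition KR_rel ::
    "nat \<Rightarrow> nat set \<Rightarrow> (nat \<times> nat) multiset \<Rightarrow> nat set \<Rightarrow> (nat \<times> nat) multiset \<Rightarrow> bool" where
  "KR_rel d v S w S' \<longleftrightarrow>
     monomial d v S \<and> monomial d v S' \<and> w \<subseteq> {1..2 * d} \<and>
     (\<forall>x y. x \<le> y \<longrightarrow> qcount S y x = qcount S' y x + depth S y x) \<and>
     (\<forall>z. card (v \<inter> {1..z}) = card (w \<inter> {1..z}) + depth S z z)"

lemma qcount_sum: "qcount (sum f I) y x = (\<Sum>i\<in>I. qcount (f i) y x)"
  by (induction I rule: infinite_finite_induct) (auto simp: qcount_def)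

lemma sum_of_bool_le: "D \<le> n \<Longrightarrow> (\<Sum>j = Suc 0..n. of_bool (j \<le> D)) = (D :: nat)"
proof -
  assume "D \<le> n"
  then have "(\<Sum>j = Suc 0..n. of_bool (j \<le> D)) = (\<Sum>j = Suc 0..D. 1 :: nat)"
    by (intro sum.mono_neutral_cong_right) auto
  then show ?thesis by simp
qed

lemma block_w_in:
  assumes "A \<in> block_positions xs"
  shows "fst (block_w (nths xs A)) \<in> fst ` set xs" "snd (block_w (nths xs A)) \<in> snd ` set xs"
proof -
  obtain l h where lh: "A = {l..<Suc h}" "l \<le> h" "h < length xs"
    using assms by (elim block_positionsE) blast
  have "nths xs A \<noteq> []"
    using lh by (simp add: nths_interval del: upt_Suc)
  then have "last (nths xs A) \<in> set xs" "hd (nths xs A) \<in> set xs"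
    by (meson in_set_nthsD last_in_set hd_in_set)+
  then show "fst (block_w (nths xs A)) \<in> fst ` set xs" "snd (block_w (nths xs A)) \<in> snd ` set xs"
    by (auto simp: block_w_def)
qed

lemma card_Int_Suc:
  "card (A \<inter> {1..Suc z}) = card (A \<inter> {1..z}) + of_bool (Suc z \<in> A)"
proof -
  have "{1..Suc z} = insert (Suc z) {1..z}"
    by auto
  then show ?thesis by (auto simp: Int_insert_right)
qed

locale KR =
  fixes d :: nat and v :: "nat set"
  assumes v_subset: "v \<subseteq> {1..2 * d}"
begin

lemma monomial_pos: "monomial d v S \<Longrightarrow> p \<in># S \<Longrightarrow> fst p > 0 \<and> snd p > 0"
  using v_subset by (cases p) (fastforce simp: monomial_def roots_def)

lemma row_empty: "monomial d v S \<Longrightarrow> z \<in> v \<Longrightarrow> (z, c) \<notin># S"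
  by (auto simp: monomial_def roots_def)

lemma column_empty: "monomial d v S \<Longrightarrow> z \<notin> v \<Longrightarrow> (r, z) \<notin># S"
  by (auto simp: monomial_def roots_def)

section \<open>From the blocks of a monomial to equations for depths\<close>

context
  fixes S w S'
  assumes S: "monomial d v S" and pi: "KR_pi v S = (w, S')"
begin

abbreviation (input) "arr j \<equiv> arrangement (layer S j)"

private lemma set_arr: "set (arr j) = set_mset (layer S j)"
  by (rule set_arrangement_layer)

private lemma arr_member: "p \<in> set (arr j) \<Longrightarrow> p \<in># S"
  unfolding set_arr by (simp add: layer_def)

private lemma arr_gt: "p \<in> set (arr j) \<Longrightarrow> snd p < fst p"
  using S arr_member by (fastforce simp: monomial_def roots_def)

private lemma arr_meets: "1 \<le> j \<Longrightarrow> (\<exists>p\<in>set (arr j). p \<in> quadrant y x) \<longleftrightarrow> j \<le> depth S y x"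
  unfolding set_arr using layer_meets_quadrant_iff[of S j y x] monomial_pos[OF S] by blast

private lemma S'_eq:
  "S' = (\<Sum>j = 1..size S. filter_mset (\<lambda>p. fst p > snd p) (mset (zip (map fst (arr j)) (map snd (tl (arr j))))))"
proof -
  have "S' = (\<Sum>b\<in>block_indices S. block_prime (block S b))"
    using pi by (simp add: KR_pi_def Let_def)
  also have "\<dots> = (\<Sum>j = 1..size S. \<Sum>A\<in>block_positions (arr j). block_prime (nths (arr j) A))"
    unfolding block_indices_def block_def
    by (subst sum.Sigma) (auto simp: finite_block_positions split_def)
  finally show ?thesis
    by (simp only: sum_block_prime)
qed

private lemma w_eq:
  "w = (v - (\<Union>j\<in>{1..size S}. (\<lambda>A. snd (block_w (nths (arr j) A))) ` block_positions (arr j)))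
      \<union> (\<Union>j\<in>{1..size S}. (\<lambda>A. fst (block_w (nths (arr j) A))) ` block_positions (arr j))"
  (is "_ = (v - ?C) \<union> ?R")
proof -
  have "snd ` (\<lambda>b. block_w (block S b)) ` block_indices S = ?C"
    "fst ` (\<lambda>b. block_w (block S b)) ` block_indices S = ?R"
    by (force simp: block_indices_def block_def)+
  then show ?thesis
    using pi by (auto simp: KR_pi_def Let_def)
qed

private lemma monomial_S': "monomial d v S'"
proof -
  have "p \<in> roots d v" if "p \<in># S'" for p
  proof -
    obtain r c where p: "p = (r, c)" by (cases p)
    obtain j where j: "(r, c) \<in> set (zip (map fst (arr j)) (map snd (tl (arr j))))" "c < r"
      using \<open>p \<in># S'\<close> p by (auto simp: S'_eq set_mset_sum)
    have "set (tl (arr j)) \<subseteq> set (arr j)"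
      by (cases "arr j") auto
    then obtain q q' where "q \<in># S" "r = fst q" "q' \<in># S" "c = snd q'"
      using set_zip_leftD[OF j(1)] set_zip_rightD[OF j(1)] arr_member by fastforce
    then show ?thesis
      using S j(2) p by (auto simp: monomial_def roots_def)
  qed
  then show ?thesis by (auto simp: monomial_def)
qed

private lemma qcount_S': "x \<le> y \<Longrightarrow> qcount S y x = qcount S' y x + depth S y x"
proof -
  assume "x \<le> y"
  let ?f = "\<lambda>j. filter_mset (\<lambda>p. fst p > snd p) (mset (zip (map fst (arr j)) (map snd (tl (arr j)))))"
  have "qcount S y x = (\<Sum>j = 1..size S. qcount (layer S j) y x)"
    using sum_layers[of S] monomial_pos[OF S] by (simp flip: qcount_sum)
  also have "\<dots> = (\<Sum>j = 1..size S. qcount (?f j) y x + of_bool (j \<le> depth S y x))"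
  proof (rule sum.cong)
    fix j assume "j \<in> {1..size S}"
    then show "qcount (layer S j) y x = qcount (?f j) y x + of_bool (j \<le> depth S y x)"
      using filter_quadrant_shift[of "arr j" x y] arrangement_layer[of S j] arr_meets[of j y x] \<open>x \<le> y\<close>
      by (simp add: qcount_def)
  qed simp
  also have "\<dots> = qcount S' y x + depth S y x"
    by (simp add: sum.distrib sum_of_bool_le depth_le_size S'_eq qcount_sum del: sum_of_bool_eq)
  finally show ?thesis .
qed

private lemma ex_level:
  "a \<le> b \<Longrightarrow> b \<le> n \<Longrightarrow> (\<exists>j\<in>{1..n}. j \<le> b \<and> \<not> j \<le> a) \<longleftrightarrow> a \<noteq> (b :: nat)"
  by (auto intro: bexI[of _ b])

text \<open>The corner \<open>depth S (Suc z) z\<close> mediates between the two diagonal values. If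
  \<open>Suc z\<close> is in \<open>v\<close>, its row is empty and the corner equals the old value;
  otherwise its column is empty and the corner equals the new one. The remaining jump is at most
  one, and it occurs exactly if some layer has a block starting, respectively ending, at
  \<open>Suc z\<close>.\<close>

private lemma diagonal_step:
  "of_bool (Suc z \<in> v) + depth S z z = of_bool (Suc z \<in> w) + depth S (Suc z) (Suc z)"
proof (cases "Suc z \<in> v")
  case True
  have arr: "Suc z \<notin> fst ` set (arr j)" for j
    using True row_empty[OF S] arr_member by fastforce
  have "Suc z \<notin> (\<lambda>A. fst (block_w (nths (arr j) A))) ` block_positions (arr j)" for j
  proof
    assume "Suc z \<in> (\<lambda>A. fst (block_w (nths (arr j) A))) ` block_positions (arr j)"
    then obtain A where A: "A \<in> block_positions (arr j)" "Suc z = fst (block_w (nths (arr j) A))"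
      by (elim imageE)
    then show False
      using block_w_in(1)[OF A(1)] arr[of j] by simp
  qed
  then have "Suc z \<in> w \<longleftrightarrow> \<not> (\<exists>j\<in>{1..size S}.
      Suc z \<in> (\<lambda>A. snd (block_w (nths (arr j) A))) ` block_positions (arr j))"
    using True unfolding w_eq by blast
  also have "(\<exists>j\<in>{1..size S}. Suc z \<in> (\<lambda>A. snd (block_w (nths (arr j) A))) ` block_positions (arr j))
      \<longleftrightarrow> (\<exists>j\<in>{1..size S}. j \<le> depth S (Suc z) (Suc z) \<and> \<not> j \<le> depth S (Suc z) z)"
  proof (rule bex_cong)
    fix j assume "j \<in> {1..size S}"
    then show "Suc z \<in> (\<lambda>A. snd (block_w (nths (arr j) A))) ` block_positions (arr j) \<longleftrightarrow>
        j \<le> depth S (Suc z) (Suc z) \<and> \<not> j \<le> depth S (Suc z) z"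
      using arrangement_layer[of S j] arr
      by (subst block_starts) (auto simp: arr_meets arr_gt[of "(_, _)", simplified])
  qed simp
  also have "\<dots> \<longleftrightarrow> depth S (Suc z) z \<noteq> depth S (Suc z) (Suc z)"
    by (intro ex_level depth_mono depth_le_size) auto
  finally have "Suc z \<in> w \<longleftrightarrow> depth S (Suc z) z = depth S (Suc z) (Suc z)"
    by simp
  moreover have "depth S (Suc z) z = depth S z z"
    using row_empty[OF S True] by (intro depth_row_empty)
  moreover have "depth S (Suc z) z \<le> depth S (Suc z) (Suc z)"
    by (simp add: depth_mono)
  moreover have "depth S (Suc z) (Suc z) \<le> depth S (Suc z) z + 1"
    using depth_step[of S "Suc z" z] depth_mono[of "Suc z" "Suc (Suc z)" z z S] by simp
  ultimately show ?thesis
    using True by auto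
next
  case False
  have "Suc z \<in> w \<longleftrightarrow> (\<exists>j\<in>{1..size S}.
      Suc z \<in> (\<lambda>A. fst (block_w (nths (arr j) A))) ` block_positions (arr j))"
    using False by (auto simp: w_eq)
  also have "\<dots> \<longleftrightarrow> (\<exists>j\<in>{1..size S}. j \<le> depth S z z \<and> \<not> j \<le> depth S (Suc z) z)"
  proof (rule bex_cong)
    fix j assume "j \<in> {1..size S}"
    then show "Suc z \<in> (\<lambda>A. fst (block_w (nths (arr j) A))) ` block_positions (arr j) \<longleftrightarrow>
        j \<le> depth S z z \<and> \<not> j \<le> depth S (Suc z) z"
      using arrangement_layer[of S j]
      by (subst block_ends) (auto simp: arr_meets arr_gt[of "(_, _)", simplified])
  qed simp
  also have "\<dots> \<longleftrightarrow> depth S (Suc z) z \<noteq> depth S z z"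
    by (intro ex_level depth_mono depth_le_size) auto
  finally have "Suc z \<in> w \<longleftrightarrow> depth S (Suc z) z \<noteq> depth S z z"
    by simp
  moreover have "depth S (Suc z) z = depth S (Suc z) (Suc z)"
    using depth_column_empty[of z S "Suc z"] column_empty[OF S False] by simp
  moreover have "depth S (Suc z) z \<le> depth S z z"
    by (simp add: depth_mono)
  moreover have "depth S z z \<le> depth S (Suc z) z + 1"
    using depth_step[of S z z] depth_mono[of z z z "Suc z" S] by simp
  ultimately show ?thesis
    using False by auto
qed

lemma KR_pi_rel: "KR_rel d v S w S'"
  unfolding KR_rel_def
proof (intro conjI allI impI)
  have "fst (block_w (nths (arr j) A)) \<in> {1..2 * d}" if A: "A \<in> block_positions (arr j)" for A j
  proof -
    obtain p where "p \<in> set (arr j)" "fst (block_w (nths (arr j) A)) = fst p"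
      using block_w_in(1)[OF A] by (elim imageE)
    then show ?thesis
      using S arr_member[of p j] by (auto simp: monomial_def roots_def)
  qed
  then show "w \<subseteq> {1..2 * d}"
    using v_subset unfolding w_eq by blast
  fix z show "card (v \<inter> {1..z}) = card (w \<inter> {1..z}) + depth S z z"
  proof (induction z)
    case 0
    then show ?case using depth_0_right[OF S v_subset] by simp
  next
    case (Suc z)
    then show ?case
      using diagonal_step[of z] card_Int_Suc[of v z] card_Int_Suc[of w z] by linarith
  qed
qed (use S monomial_S' qcount_S' in auto)

end

end

section \<open>Injectivity of \<open>\<pi>\<close>\<close>

text \<open>The order of the forward recursion: from the left and top boundary to the outer corner
  of each cell. The bound x < y keeps all four corners in the region x <= y.\<close>

lemma triangle_induct [consumes 1, case_names left top step]:
  assumes "x \<le> y" "\<And>y. P y 0" "\<And>x y. n \<le> y \<Longrightarrow> x \<le> y \<Longrightarrow> P y x"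
    and step: "\<And>x y. x < y \<Longrightarrow> P (Suc y) x \<Longrightarrow> P (Suc y) (Suc x) \<Longrightarrow> P y x \<Longrightarrow> P y (Suc x)"
  shows "P y (x :: nat)"
  using \<open>x \<le> y\<close>
proof (induction "x + (n - y)" arbitrary: x y rule: less_induct)
  case less
  show ?case
  proof (cases "x = 0 \<or> n \<le> y")
    case True
    then show ?thesis using assms(2,3) less.prems by auto
  next
    case False
    then obtain x' where "x = Suc x'"
      by (cases x) auto
    then show ?thesis
      using False less.prems step[of x' y] less.hyps[of x' "Suc y"] less.hyps[of x "Suc y"] less.hyps[of x' y]
      by auto
  qed
qed

text \<open>The order of the inverse recursion: from the diagonal to the inner corner
  \<open>(Suc y, x)\<close>. For x = y the outer corner falls outside the region, hence the
  conditional hypothesis.\<close>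

lemma triangle_diagonal_induct [consumes 1, case_names diagonal step]:
  assumes "x \<le> y" "\<And>x. P x x"
    and step: "\<And>x y. x \<le> y \<Longrightarrow> (x < y \<Longrightarrow> P y (Suc x)) \<Longrightarrow> P (Suc y) (Suc x) \<Longrightarrow> P y x \<Longrightarrow> P (Suc y) x"
  shows "P y (x :: nat)"
  using \<open>x \<le> y\<close>
proof (induction "y - x" arbitrary: x y rule: less_induct)
  case less
  show ?case
  proof (cases "x = y")
    case True
    then show ?thesis using assms(2) by simp
  next
    case False
    then obtain y' where y': "y = Suc y'" "x \<le> y'"
      using less.prems by (cases y) auto
    have "P y' (Suc x)" if "x < y'"
      using that y' by (intro less.hyps) auto
    moreover have "P (Suc y') (Suc x)" "P y' x"
      using y' by (intro less.hyps; simp)+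
    ultimately show ?thesis
      unfolding y'(1) using step[OF y'(2)] by blast
  qed
qed

lemma subset_eq_if_card_Int_eq:
  assumes "A \<subseteq> {1..n::nat}" "B \<subseteq> {1..n}" "\<And>z. card (A \<inter> {1..z}) = card (B \<inter> {1..z})"
  shows "A = B"
proof -
  have "Suc z \<in> A \<longleftrightarrow> Suc z \<in> B" for z
    using assms(3)[of z] assms(3)[of "Suc z"] card_Int_Suc[of A z] card_Int_Suc[of B z]
    by (simp only: add_left_cancel of_bool_eq_iff)
  moreover have "0 \<notin> A" "0 \<notin> B"
    using assms by auto
  ultimately have "z \<in> A \<longleftrightarrow> z \<in> B" for z
    by (cases z) auto
  then show ?thesis by blast
qed

section \<open>Local rules, and uniqueness of image and preimage\<close>

context KR
begin

lemma finite_roots: "finite (roots d v)"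
  by (rule finite_subset[of _ "{1..2 * d} \<times> {1..2 * d}"]) (use v_subset in \<open>auto simp: roots_def\<close>)

text \<open>A multiplicity is the alternating sum of \<open>qcount\<close> over the corners of its
  cell. Roots have their column below their row, so these corners all satisfy x <= y.\<close>

lemma monomial_eqI:
  assumes "monomial d v S" "monomial d v T" "\<And>x y. x \<le> y \<Longrightarrow> qcount S y x = qcount T y x"
  shows "S = T"
proof (rule multiset_eqI)
  fix p
  show "count S p = count T p"
  proof (cases "p \<in> roots d v")
    case True
    then obtain y x where "p = (Suc y, Suc x)" "x < y"
      using v_subset by (cases p; cases "fst p"; cases "snd p") (auto simp: roots_def)
    then show ?thesis
      using assms(3)[of x y] assms(3)[of "Suc x" y] assms(3)[of x "Suc y"] assms(3)[of "Suc x" "Suc y"]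
        qcount_rec[of S y x] qcount_rec[of T y x] by simp
  next
    case False
    then have "p \<notin># S" "p \<notin># T"
      using assms(1,2) by (auto simp: monomial_def)
    then show ?thesis by (simp add: not_in_iff)
  qed
qed

lemma KR_rel_image_unique:
  assumes "KR_rel d v S w1 S1" "KR_rel d v S w2 S2"
  shows "w1 = w2" "S1 = S2"
proof -
  show "w1 = w2"
    by (rule subset_eq_if_card_Int_eq[of _ "2 * d"]) (use assms in \<open>auto simp: KR_rel_def\<close>)
  show "S1 = S2"
    by (rule monomial_eqI) (use assms in \<open>auto simp: KR_rel_def\<close>)
qed

lemma KR_pi_iff_rel: "monomial d v S \<Longrightarrow> KR_pi v S = (w, S') \<longleftrightarrow> KR_rel d v S w S'"
  using KR_pi_rel KR_rel_image_unique by (metis surj_pair)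

text \<open>The alternating sum of the counting identity over the four corners; the cells of
  \<open>S\<close> and \<open>S'\<close> enter on opposite sides.\<close>

lemma KR_rel_cell:
  assumes "KR_rel d v S w S'" "x < y"
  shows "count S' (Suc y, Suc x) + depth S y (Suc x) + depth S (Suc y) x =
    count S (Suc y, Suc x) + depth S (Suc y) (Suc x) + depth S y x"
proof -
  have "qcount S y' x' = qcount S' y' x' + depth S y' x'" if "x' \<le> y'" for x' y'
    using assms(1) that by (auto simp: KR_rel_def)
  from this[of x y] this[of "Suc x" y] this[of x "Suc y"] this[of "Suc x" "Suc y"] show ?thesis
    using assms(2) qcount_rec[of S y x] qcount_rec[of S' y x] by simp
qed

lemma depth_cell_bounds:
  "depth S (Suc y) x \<le> depth S y x" "depth S (Suc y) x \<le> depth S (Suc y) (Suc x)"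
  "depth S y x \<le> depth S y (Suc x)" "depth S (Suc y) (Suc x) \<le> depth S y (Suc x)"
  "depth S y (Suc x) \<le> depth S (Suc y) x + 1"
  using depth_step by (auto intro: depth_mono)

text \<open>If the cell is not in \<open>S\<close>, the outer depth is the maximum of the two side
  depths, and the cell identity makes the multiplicity in \<open>S'\<close> the excess of their
  minimum over the inner depth. A positive excess forces the full rise by one.\<close>

lemma KR_rel_member:
  assumes "KR_rel d v S w S'" "x < y" "(Suc y, Suc x) \<in># S'"
  shows "depth S y (Suc x) = depth S (Suc y) x + 1"
proof -
  have "count S' (Suc y, Suc x) > 0"
    using assms(3) by simp
  moreover have "count S (Suc y, Suc x) = 0" "depth S y (Suc x) = max (depth S (Suc y) (Suc x)) (depth S y x)"
    if "(Suc y, Suc x) \<notin># S"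
    using that by (simp_all add: not_in_iff depth_nonmember)
  ultimately show ?thesis
    using KR_rel_cell[OF assms(1,2)] depth_member[of y x S] depth_cell_bounds[where S = S and y = y and x = x]
    by linarith
qed

text \<open>The dual of \<open>depth_nonmember\<close>. If the cell is in \<open>S\<close>, the
  identity with zero on the side of \<open>S'\<close> leaves room only for multiplicity one and side
  depths equal to the inner depth.\<close>

lemma KR_rel_nonmember:
  assumes "KR_rel d v S w S'" "x < y" "(Suc y, Suc x) \<notin># S'"
  shows "depth S (Suc y) x = min (depth S (Suc y) (Suc x)) (depth S y x)"
proof -
  have "count S' (Suc y, Suc x) = 0"
    using assms(3) by (simp add: not_in_iff)
  then show ?thesis
    using KR_rel_cell[OF assms(1,2)] depth_rec[of S y x] depth_cell_bounds[where S = S and y = y and x = x]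
    by (auto simp: not_in_iff max_def min_def split: if_splits)
qed

lemma depth_below_diagonal:
  assumes "monomial d v S"
  shows "depth S (Suc x) x = min (depth S (Suc x) (Suc x)) (depth S x x)"
proof (cases "Suc x \<in> v")
  case True
  then have "depth S (Suc x) x = depth S x x"
    using row_empty[OF assms] by (intro depth_row_empty)
  then show ?thesis
    using depth_cell_bounds(2)[of S x x] by simp
next
  case False
  then have "depth S (Suc x) (Suc x) = depth S (Suc x) x"
    using column_empty[OF assms] by (intro depth_column_empty)
  then show ?thesis
    using depth_cell_bounds(1)[of S x x] by simp
qed

lemma KR_rel_depth_unique:
  assumes "KR_rel d v S w M" "KR_rel d v T w M" "x \<le> y"
  shows "depth S y x = depth T y x"
  using assms(3)
proof (induction rule: triangle_diagonal_induct)
  case (diagonal x)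
  have "card (v \<inter> {1..x}) = card (w \<inter> {1..x}) + depth S x x"
    "card (v \<inter> {1..x}) = card (w \<inter> {1..x}) + depth T x x"
    using assms(1,2) unfolding KR_rel_def by blast+
  then show ?case by simp
next
  case (step x y)
  show ?case
  proof (cases "x = y")
    case True
    then show ?thesis
      using step depth_below_diagonal assms(1,2) by (simp add: KR_rel_def)
  next
    case False
    then have "x < y" using step by simp
    then show ?thesis
      using step KR_rel_member[OF assms(1)] KR_rel_member[OF assms(2)]
        KR_rel_nonmember[OF assms(1)] KR_rel_nonmember[OF assms(2)]
      by (cases "(Suc y, Suc x) \<in># M") auto
  qed
qed

lemma KR_rel_inj:
  assumes "KR_rel d v S w M" "KR_rel d v T w M"
  shows "S = T"
proof (rule monomial_eqI)
  fix x y :: nat assume "x \<le> y"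
  then show "qcount S y x = qcount T y x"
    using assms KR_rel_depth_unique[OF assms] by (simp add: KR_rel_def)
qed (use assms in \<open>auto simp: KR_rel_def\<close>)

text \<open>Where the recursion for \<open>S'\<close> adds one, \<open>S\<close> rises by one as
  well; elsewhere the maximum is monotone. On the diagonal this yields u <= t and the dominance of T
  by u.\<close>

lemma KR_rel_depth_le:
  assumes "KR_rel d v S w S'" "x \<le> y"
  shows "depth S' y x \<le> depth S y x"
proof -
  have S: "monomial d v S" "monomial d v S'"
    using assms(1) by (auto simp: KR_rel_def)
  show ?thesis
    using assms(2)
  proof (induction rule: triangle_induct[where n = "2 * d"])
    case (step x y)
    then show ?case
      using KR_rel_member[OF assms(1), of x y] depth_rec[of S' y x]
        depth_cell_bounds[where S = S and y = y and x = x]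
      by (auto split: if_splits)
  qed (use S v_subset in \<open>auto simp: depth_0_right depth_top\<close>)
qed

end

section \<open>Surjectivity of \<open>\<pi>\<close>\<close>

text \<open>A function \<open>E\<close> that will turn out to be the depth of the monomial with image \<open>(w, M)\<close>:
  \<open>level v w M k x\<close> stands for \<open>E (x + k) x\<close>. The diagonal is prescribed by \<open>w\<close>, and the recursion
  inverts \<open>depth_rec\<close>, determining the value at one corner of a cell from the other three.\<close>

fun level :: "nat set \<Rightarrow> nat set \<Rightarrow> (nat \<times> nat) multiset \<Rightarrow> nat \<Rightarrow> nat \<Rightarrow> nat" where
  "level v w M 0 x = card (v \<inter> {1..x}) - card (w \<inter> {1..x})"
| "level v w M (Suc 0) x = min (level v w M 0 (Suc x)) (level v w M 0 x)"
| "level v w M (Suc (Suc k)) x =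
    (if (Suc (Suc (x + k)), Suc x) \<in># M then level v w M k (Suc x) - 1
     else min (level v w M (Suc k) (Suc x)) (level v w M (Suc k) x))"

text \<open>The assumption \<open>room\<close> is dominance of \<open>M\<close> by \<open>w\<close>
  in the form of \<open>dominates_iff_depth\<close>.\<close>

locale KR_preimage = KR +
  fixes w :: "nat set" and M :: "(nat \<times> nat) multiset"
  assumes w_subset: "w \<subseteq> {1..2 * d}" and card_w: "card w = card v"
    and M: "monomial d v M"
    and room: "\<And>z. card (w \<inter> {1..z}) + depth M z z \<le> card (v \<inter> {1..z})"
begin

definition E :: "nat \<Rightarrow> nat \<Rightarrow> nat" where
  "E y x = level v w M (y - x) x"

lemma E_diagonal: "card (v \<inter> {1..z}) = card (w \<inter> {1..z}) + E z z"
  using room[of z] by (simp add: E_def)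

lemma E_diagonal_step:
  "of_bool (Suc z \<in> v) + E z z = of_bool (Suc z \<in> w) + E (Suc z) (Suc z)"
  using E_diagonal[of z] E_diagonal[of "Suc z"] card_Int_Suc[of v z] card_Int_Suc[of w z] by linarith

lemma E_below_diagonal: "E (Suc x) x = min (E (Suc x) (Suc x)) (E x x)"
  by (simp add: E_def)

lemma E_rec:
  assumes "x < y"
  shows "E (Suc y) x = (if (Suc y, Suc x) \<in># M then E y (Suc x) - 1 else min (E (Suc y) (Suc x)) (E y x))"
proof -
  obtain k where "y = Suc (x + k)"
    using assms less_iff_Suc_add by auto
  then show ?thesis
    by (simp add: E_def Suc_diff_le)
qed

text \<open>This carries \<open>room\<close> from the diagonal into the whole region. It guarantees
  that the subtraction of one in \<open>level\<close> is never truncated at a cell of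
  \<open>M\<close>.\<close>

lemma depth_le_E: "x \<le> y \<Longrightarrow> depth M y x \<le> E y x"
proof (induction rule: triangle_diagonal_induct)
  case (diagonal x)
  then show ?case using room[of x] E_diagonal[of x] by linarith
next
  case (step x y)
  show ?case
  proof (cases "x = y")
    case True
    then show ?thesis
      using step depth_cell_bounds(1,2)[of M y x] E_below_diagonal[of x] by auto
  next
    case False
    then have "x < y" using step by simp
    then show ?thesis
      using step depth_cell_bounds(1,2)[of M y x] depth_rec[of M y x] E_rec[of x y] by auto
  qed
qed

lemma E_pos: "x < y \<Longrightarrow> (Suc y, Suc x) \<in># M \<Longrightarrow> 0 < E y (Suc x)"
  using depth_le_E[of "Suc x" y] depth_member[of y x M] by simp

text \<open>\<open>E\<close> has steps 0 or 1 in both directions, as a depth function must; the cell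
  computations below rest on this.\<close>

lemma E_bounds:
  "x \<le> y \<Longrightarrow> E (Suc y) x \<le> E y x \<and> E y x \<le> E (Suc y) x + 1 \<and>
     E (Suc y) x \<le> E (Suc y) (Suc x) \<and> E (Suc y) (Suc x) \<le> E (Suc y) x + 1"
proof (induction rule: triangle_diagonal_induct)
  case (diagonal x)
  have "E x x \<le> E (Suc x) (Suc x) + 1" "E (Suc x) (Suc x) \<le> E x x + 1"
    using E_diagonal_step[of x] by (auto simp: of_bool_def split: if_splits)
  then show ?case
    using E_below_diagonal[of x] by (auto simp: min_def)
next
  case (step x y)
  show ?case
  proof (cases "(Suc (Suc y), Suc x) \<in># M")
    case True
    have "0 < E (Suc y) (Suc x)"
      using E_pos[of x "Suc y"] True step(1) by simp
    then show ?thesis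
      using step True E_rec[of x "Suc y"] by auto
  next
    case False
    then show ?thesis
      using step E_rec[of x "Suc y"] by (auto simp: min_def)
  qed
qed

text \<open>Together with \<open>E_column_empty\<close> this shows that rows in \<open>v\<close> and
  columns outside \<open>v\<close> need no elements, so that the preimage can be supported on the
  roots.\<close>

lemma E_row_empty: "x \<le> y \<Longrightarrow> Suc y \<in> v \<Longrightarrow> E (Suc y) x = E y x"
proof (induction rule: triangle_diagonal_induct)
  case (diagonal x)
  then show ?case
    using E_diagonal_step[of x] E_below_diagonal[of x] by (auto simp: of_bool_def split: if_splits)
next
  case (step x y)
  then show ?case
    using E_rec[of x "Suc y"] E_bounds[of x y] row_empty[OF M, of "Suc (Suc y)"] by auto
qed

lemma E_column_empty: "x \<le> y \<Longrightarrow> Suc x \<notin> v \<Longrightarrow> E (Suc y) x = E (Suc y) (Suc x)"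
proof (induction rule: triangle_diagonal_induct)
  case (diagonal x)
  then show ?case
    using E_diagonal_step[of x] E_below_diagonal[of x] by (auto simp: of_bool_def split: if_splits)
next
  case (step x y)
  then show ?case
    using E_rec[of x "Suc y"] E_bounds[of "Suc x" "Suc y"] column_empty[OF M, of "Suc x"] by auto
qed

lemma E_mono_y:
  assumes "x \<le> y" "y \<le> y'"
  shows "E y' x \<le> E y x"
  using assms(2)
proof (induction rule: dec_induct)
  case (step n)
  then show ?case using E_bounds[of x n] assms(1) by simp
qed simp

lemma E_mono_x:
  assumes "x \<le> x'" "x' \<le> y"
  shows "E y x \<le> E y x'"
  using assms(1)
proof (induction rule: dec_induct)
  case (step n)
  then obtain y' where "y = Suc y'" "n \<le> y'"
    using assms(2) by (cases y) auto
  then show ?case using step E_bounds[of n y'] by simp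
qed simp

lemma E_left: "E y 0 = 0"
  using E_mono_y[of 0 0 y] E_diagonal[of 0] by simp

lemma E_top:
  assumes "2 * d \<le> y" "x \<le> y"
  shows "E y x = 0"
proof -
  have "v \<inter> {1..y} = v" "w \<inter> {1..y} = w"
    using v_subset w_subset assms by auto
  then have "E y y = 0"
    using E_diagonal[of y] card_w by simp
  then show ?thesis
    using E_mono_x[of x y y] assms by simp
qed

text \<open>The multiplicities are those that \<open>KR_rel_cell\<close> dictates with
  \<open>E\<close> in place of the depth; \<open>preimage_cell\<close> confirms that the difference
  is not truncated.\<close>

definition preimage :: "(nat \<times> nat) multiset" where
  "preimage = (\<Sum>p\<in>roots d v. replicate_mset
     (count M p + E (fst p - 1) (snd p) + E (fst p) (snd p - 1)
       - E (fst p) (snd p) - E (fst p - 1) (snd p - 1)) p)"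

lemma count_preimage:
  "count preimage p = (if p \<in> roots d v then
     count M p + E (fst p - 1) (snd p) + E (fst p) (snd p - 1)
       - E (fst p) (snd p) - E (fst p - 1) (snd p - 1) else 0)"
  unfolding preimage_def by (simp add: count_sum finite_roots sum.delta' flip: eq_commute)

lemma monomial_preimage: "monomial d v preimage"
proof -
  have "p \<in> roots d v" if "p \<in># preimage" for p
    using that count_preimage[of p] by (metis count_eq_zero_iff)
  then show ?thesis by (auto simp: monomial_def)
qed

lemma preimage_cell:
  assumes "x < y"
  shows "count preimage (Suc y, Suc x) + E (Suc y) (Suc x) + E y x =
    count M (Suc y, Suc x) + E y (Suc x) + E (Suc y) x"
proof (cases "(Suc y, Suc x) \<in> roots d v")
  case True
  have "E (Suc y) (Suc x) + E y x \<le> count M (Suc y, Suc x) + E y (Suc x) + E (Suc y) x"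
  proof (cases "(Suc y, Suc x) \<in># M")
    case True
    then have "1 \<le> count M (Suc y, Suc x)" "E y (Suc x) = E (Suc y) x + 1"
      using E_rec[OF assms] E_pos[OF assms] by simp_all
    then show ?thesis
      using E_bounds[of "Suc x" y] assms E_mono_x[of x "Suc x" y] by linarith
  next
    case False
    then show ?thesis
      using E_rec[OF assms] E_bounds[of "Suc x" y] E_mono_x[of x "Suc x" y] assms
      by (simp add: min_def)
  qed
  then show ?thesis
    using True by (simp add: count_preimage)
next
  case False
  then have M0: "count M (Suc y, Suc x) = 0"
    using M by (auto simp: monomial_def not_in_iff[symmetric])
  \<comment> \<open>A cell off the diagonal fails to be a root for one of three reasons, and each
    makes the alternating sum of \<open>E\<close> over its corners vanish.\<close>
  consider "2 * d \<le> y" | "Suc y \<in> v" | "Suc x \<notin> v"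
    using False assms by (force simp: roots_def)
  then have "E (Suc y) (Suc x) + E y x = E y (Suc x) + E (Suc y) x"
  proof cases
    case 1
    then show ?thesis using assms by (simp add: E_top)
  next
    case 2
    then show ?thesis using assms by (simp add: E_row_empty)
  next
    case 3
    then obtain y' where "y = Suc y'" "x \<le> y'"
      using assms by (cases y) auto
    then show ?thesis using 3 E_column_empty[of x y'] E_column_empty[of x y] by simp
  qed
  then show ?thesis
    using False M0 by (simp add: count_preimage)
qed

text \<open>Both sides vanish on the left and top boundary, so it suffices that \<open>E\<close>
  obeys \<open>depth_rec\<close> for the new monomial. This is the inverse rule turned back: the
  cell identity and the unit steps let each rule be recovered from the other.\<close>

lemma depth_preimage: "x \<le> y \<Longrightarrow> depth preimage y x = E y x"
proof (induction rule: triangle_induct[where n = "2 * d"])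
  case (left y)
  then show ?case
    using E_left depth_0_right[OF monomial_preimage v_subset] by simp
next
  case (top x y)
  then show ?case
    using E_top depth_top[OF monomial_preimage] by simp
next
  case (step x y)
  have bounds: "E (Suc y) x \<le> E (Suc y) (Suc x)" "E (Suc y) (Suc x) \<le> E y (Suc x)"
    "E y (Suc x) \<le> E (Suc y) (Suc x) + 1" "E y x \<le> E y (Suc x)" "E y (Suc x) \<le> E y x + 1"
    using E_bounds[of x y] E_bounds[of "Suc x" y] E_bounds[of x "y - 1"] step(1) by auto
  have "E y (Suc x) = (if (Suc y, Suc x) \<in># preimage then E (Suc y) x + 1
      else max (E (Suc y) (Suc x)) (E y x))"
  proof (cases "(Suc y, Suc x) \<in># M")
    case True
    then have "E y (Suc x) = E (Suc y) x + 1"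
      using E_rec[OF step(1)] E_pos[OF step(1)] by simp
    moreover have "1 \<le> count M (Suc y, Suc x)"
      using True by simp
    moreover have "count preimage (Suc y, Suc x) = 0" if "(Suc y, Suc x) \<notin># preimage"
      using that by (simp add: not_in_iff)
    ultimately show ?thesis
      using preimage_cell[OF step(1)] bounds by (simp only: split: if_split) linarith
  next
    case False
    then have "E (Suc y) x = min (E (Suc y) (Suc x)) (E y x)"
      using E_rec[OF step(1)] by simp
    moreover have "count M (Suc y, Suc x) = 0"
      using False by (simp add: not_in_iff)
    moreover have "count preimage (Suc y, Suc x) = 0" if "(Suc y, Suc x) \<notin># preimage"
      using that by (simp add: not_in_iff)
    moreover have "1 \<le> count preimage (Suc y, Suc x)" if "(Suc y, Suc x) \<in># preimage"
      using that by simp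
    ultimately show ?thesis
      using preimage_cell[OF step(1)] bounds by (simp only: split: if_split) linarith
  qed
  then show ?case
    using step by (simp add: depth_rec)
qed

lemma qcount_preimage: "x \<le> y \<Longrightarrow> qcount preimage y x = qcount M y x + E y x"
proof (induction rule: triangle_induct[where n = "2 * d"])
  case (left y)
  then show ?case
    using E_left qcount_0_right[OF monomial_preimage v_subset] qcount_0_right[OF M v_subset] by simp
next
  case (top x y)
  then show ?case
    using E_top qcount_top[OF monomial_preimage] qcount_top[OF M] by simp
next
  case (step x y)
  then show ?case
    using qcount_rec[of preimage y x] qcount_rec[of M y x] preimage_cell[OF step(1)] by linarith
qed

lemma KR_rel_preimage: "KR_rel d v preimage w M"
  using monomial_preimage M w_subset qcount_preimage depth_preimage E_diagonal
  by (simp add: KR_rel_def)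

end

text \<open>\<open>KR_phi\<close> chooses a preimage by \<open>inv_into\<close>; existence is what
  allows its values to be computed with.\<close>

lemma (in KR) KR_pi_surj:
  assumes "w \<subseteq> {1..2 * d}" "card w = card v" "monomial d v M"
    and "\<And>z. card (w \<inter> {1..z}) + depth M z z \<le> card (v \<inter> {1..z})"
  shows "\<exists>S. monomial d v S \<and> KR_pi v S = (w, M)"
proof -
  interpret KR_preimage d v w M
    by unfold_locales (use assms in auto)
  show ?thesis
    using KR_rel_preimage monomial_preimage KR_pi_iff_rel by blast
qed

section \<open>Dominance as a counting condition\<close>

lemma sorted_list_of_set_nth_le_iff:
  fixes n :: nat
  assumes "u \<subseteq> {1..n}" "i < card u"
  shows "sorted_list_of_set u ! i \<le> z \<longleftrightarrow> i < card (u \<inter> {1..z})"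
proof -
  let ?xs = "sorted_list_of_set u"
  let ?K = "{k. k < card u \<and> ?xs ! k \<le> z}"
  have fin: "finite u"
    using assms(1) by (rule finite_subset) simp
  have set: "set ?xs = u" and len: "length ?xs = card u" and dist: "distinct ?xs"
    using fin by auto
  have "u \<inter> {1..z} = (!) ?xs ` ?K"
  proof (intro equalityI subsetI)
    fix a assume "a \<in> u \<inter> {1..z}"
    then have "a \<in> set ?xs" "a \<le> z"
      using set by auto
    then obtain k where "k < card u" "a = ?xs ! k" "a \<le> z"
      unfolding in_set_conv_nth len by blast
    then show "a \<in> (!) ?xs ` ?K" by blast
  next
    fix a assume "a \<in> (!) ?xs ` ?K"
    then obtain k where "k < length ?xs" "a = ?xs ! k" "a \<le> z"
      using len by auto
    then have "a \<in> u" "a \<le> z"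
      using nth_mem[of k ?xs] set by simp_all
    then show "a \<in> u \<inter> {1..z}" using assms(1) by auto
  qed
  moreover have "inj_on ((!) ?xs) ?K"
    using dist len by (auto simp: inj_on_def nth_eq_iff_index_eq)
  ultimately have card: "card (u \<inter> {1..z}) = card ?K"
    by (simp add: card_image)
  have mono: "?xs ! k \<le> ?xs ! l" if "k \<le> l" "l < card u" for k l
    using that len by (intro sorted_nth_mono) auto
  show ?thesis
  proof
    assume "?xs ! i \<le> z"
    then have "?xs ! k \<le> z" if "k \<le> i" for k
      using mono[OF that assms(2)] by simp
    then have "{..i} \<subseteq> ?K"
      using assms(2) by auto
    then have "card {..i} \<le> card ?K"
      by (intro card_mono) auto
    then show "i < card (u \<inter> {1..z})"
      unfolding card by simp
  next
    assume *: "i < card (u \<inter> {1..z})"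
    show "?xs ! i \<le> z"
    proof (rule ccontr)
      assume "\<not> ?xs ! i \<le> z"
      then have "k < i" if "k < card u" "?xs ! k \<le> z" for k
        using mono[of i k] that by (cases "k < i") auto
      then have "?K \<subseteq> {..<i}"
        by auto
      then have "card ?K \<le> card {..<i}"
        by (intro card_mono) auto
      then show False using * card by simp
    qed
  qed
qed

lemma set_le_iff_card:
  fixes n :: nat
  assumes "u \<subseteq> {1..n}" "x \<subseteq> {1..n}" "card u = card x"
  shows "set_le u x \<longleftrightarrow> (\<forall>z. card (x \<inter> {1..z}) \<le> card (u \<inter> {1..z}))"
proof
  assume le: "set_le u x"
  show "\<forall>z. card (x \<inter> {1..z}) \<le> card (u \<inter> {1..z})"
  proof (rule ccontr)
    assume "\<not> (\<forall>z. card (x \<inter> {1..z}) \<le> card (u \<inter> {1..z}))"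
    then obtain z where z: "card (u \<inter> {1..z}) < card (x \<inter> {1..z})"
      by (auto simp: not_le)
    let ?i = "card (u \<inter> {1..z})"
    have "card (x \<inter> {1..z}) \<le> card x"
      using finite_subset[OF assms(2)] by (intro card_mono) auto
    then have i: "?i < card x" using z by simp
    then have "sorted_list_of_set x ! ?i \<le> z"
      using z sorted_list_of_set_nth_le_iff[OF assms(2)] by blast
    moreover have "sorted_list_of_set u ! ?i \<le> sorted_list_of_set x ! ?i"
      using le i assms(3) by (simp add: set_le_def)
    ultimately show False
      using sorted_list_of_set_nth_le_iff[OF assms(1), of ?i z] i assms(3) by simp
  qed
next
  assume *: "\<forall>z. card (x \<inter> {1..z}) \<le> card (u \<inter> {1..z})"
  show "set_le u x"
    unfolding set_le_def
  proof (intro allI impI)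
    fix i assume i: "i < card u"
    let ?z = "sorted_list_of_set x ! i"
    have "i < card (x \<inter> {1..?z})"
      using sorted_list_of_set_nth_le_iff[OF assms(2), of i ?z] i assms(3) by simp
    then have "i < card (u \<inter> {1..?z})"
      using * order_less_le_trans by blast
    then show "sorted_list_of_set u ! i \<le> ?z"
      using sorted_list_of_set_nth_le_iff[OF assms(1) i] by blast
  qed
qed

lemma chain_inj_on:
  assumes "chain_in S xs"
  shows "inj_on fst (set xs)" "inj_on snd (set xs)"
  using assms by (induction xs) (fastforce simp: chain_in_def gt_def)+

context KR
begin

text \<open>Exchanging c for r changes the count up to z only if c <= z < r, and then lowers it by
  one. In a chain no row and no column repeats, so the exchanges do not interfere.\<close>

lemma card_exchange_Int:
  assumes "monomial d v M" "chain_in M xs"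
  shows "card (((v - snd ` set xs) \<union> fst ` set xs) \<inter> {1..z}) + card (set xs \<inter> quadrant z z)
    = card (v \<inter> {1..z})"
proof -
  let ?P = "{p \<in> set xs. snd p \<le> z}" and ?Q = "{p \<in> set xs. fst p \<le> z}"
  have root: "fst p \<in> {1..2 * d} - v \<and> snd p \<in> v \<and> snd p < fst p" if "p \<in> set xs" for p
    using assms that by (fastforce simp: monomial_def chain_in_def roots_def)
  have "((v - snd ` set xs) \<union> fst ` set xs) \<inter> {1..z} = (v \<inter> {1..z} - snd ` ?P) \<union> fst ` ?Q"
    using root by fastforce
  moreover have "(v \<inter> {1..z} - snd ` ?P) \<inter> fst ` ?Q = {}"
    using root by fastforce
  moreover have sub: "snd ` ?P \<subseteq> v \<inter> {1..z}"
    using root v_subset by fastforce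
  moreover have "card (snd ` ?P) = card ?P" "card (fst ` ?Q) = card ?Q"
    using chain_inj_on[OF assms(2)] by (auto intro!: card_image intro: inj_on_subset)
  moreover have "card (snd ` ?P) \<le> card (v \<inter> {1..z})"
    using sub by (intro card_mono) auto
  ultimately have "card (((v - snd ` set xs) \<union> fst ` set xs) \<inter> {1..z}) + card ?P = card (v \<inter> {1..z}) + card ?Q"
    by (simp add: card_Un_disjoint card_Diff_subset)
  moreover have "?P = ?Q \<union> (set xs \<inter> quadrant z z)"
    using root by (fastforce simp: quadrant_def)
  moreover have "?Q \<inter> (set xs \<inter> quadrant z z) = {}"
    by (auto simp: quadrant_def)
  ultimately show ?thesis
    by (simp add: card_Un_disjoint)
qed

text \<open>At a fixed cut z only the members in \<open>quadrant z z\<close> matter, and they form a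
  chain themselves. The strongest condition therefore comes from a longest chain in that
  quadrant.\<close>

lemma dominates_iff_depth:
  assumes M: "monomial d v M" and w: "w \<subseteq> {1..2 * d}" "card w = card v"
  shows "dominates v w M \<longleftrightarrow> (\<forall>z. card (w \<inter> {1..z}) + depth M z z \<le> card (v \<inter> {1..z}))"
proof -
  have exchange: "set_le ((v - snd ` set xs) \<union> fst ` set xs) w \<longleftrightarrow>
      (\<forall>z. card (w \<inter> {1..z}) + card (set xs \<inter> quadrant z z) \<le> card (v \<inter> {1..z}))"
    if xs: "chain_in M xs" for xs
  proof -
    let ?u = "(v - snd ` set xs) \<union> fst ` set xs"
    have u: "?u \<subseteq> {1..2 * d}"
      using xs M v_subset by (fastforce simp: monomial_def chain_in_def roots_def)
    \<comment> \<open>At the cut 2d no exchange is counted, so the exchanged set keeps the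
      cardinality of \<open>v\<close>.\<close>
    have "set xs \<inter> quadrant (2 * d) (2 * d) = {}"
      using xs M by (fastforce simp: monomial_def chain_in_def roots_def quadrant_def)
    then have "card ?u = card v"
      using card_exchange_Int[OF M xs, of "2 * d"] u v_subset by (simp add: Int_absorb2)
    then have "set_le ?u w \<longleftrightarrow> (\<forall>z. card (w \<inter> {1..z}) \<le> card (?u \<inter> {1..z}))"
      using u w by (intro set_le_iff_card) auto
    also have "\<dots> \<longleftrightarrow> (\<forall>z. card (w \<inter> {1..z}) + card (set xs \<inter> quadrant z z) \<le> card (v \<inter> {1..z}))"
      by (simp only: card_exchange_Int[OF M xs, symmetric] add_le_cancel_right)
    finally show ?thesis .
  qed
  show ?thesis
  proof
    assume dom: "dominates v w M"
    show "\<forall>z. card (w \<inter> {1..z}) + depth M z z \<le> card (v \<inter> {1..z})"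
    proof
      fix z
      obtain xs where xs: "chain_in M xs" "set xs \<subseteq> quadrant z z" "length xs = depth M z z"
        by (rule depth_chain)
      then have "card (set xs \<inter> quadrant z z) = depth M z z"
        using distinct_card[OF distinct_chain[OF xs(1)]] by (simp add: Int_absorb2)
      then show "card (w \<inter> {1..z}) + depth M z z \<le> card (v \<inter> {1..z})"
        using dom exchange[OF xs(1)] xs(1) unfolding dominates_def by metis
    qed
  next
    assume *: "\<forall>z. card (w \<inter> {1..z}) + depth M z z \<le> card (v \<inter> {1..z})"
    show "dominates v w M"
      unfolding dominates_def
    proof (intro allI impI)
      fix xs assume xs: "chain_in M xs"
      have "card (set xs \<inter> quadrant z z) \<le> depth M z z" for z
      proof -
        let ?ys = "filter (\<lambda>p. p \<in> quadrant z z) xs"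
        have ys: "chain_in M ?ys" "set ?ys \<subseteq> quadrant z z"
          using xs by (auto simp: chain_in_def sorted_wrt_filter)
        have "set ?ys = set xs \<inter> quadrant z z"
          by auto
        then have "length ?ys = card (set xs \<inter> quadrant z z)"
          using distinct_card[OF distinct_chain[OF ys(1)]] by simp
        then show ?thesis
          using length_le_depth[OF ys] by simp
      qed
      then show "set_le ((v - snd ` set xs) \<union> fst ` set xs) w"
        using * exchange[OF xs] by (meson add_le_cancel_left order_trans)
    qed
  qed
qed

end

section \<open>Symmetry\<close>

text \<open>Since j^* = 2d + 1 - j, the strict bound y < c^* is c <= 2d - y, and c's counterpart r^*
  <= x is r > 2d - x; the half-open shape reproduces itself.\<close>

lemma quadrant_root_sharp:
  assumes "p \<in> roots d v" "v \<subseteq> {1..2 * d}" "x \<le> 2 * d" "y \<le> 2 * d"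
  shows "root_sharp d p \<in> quadrant y x \<longleftrightarrow> p \<in> quadrant (2 * d - x) (2 * d - y)"
  using assms by (cases p) (auto simp: roots_def root_sharp_def quadrant_def star_def)

text \<open>The elements up to z that are missing from the sharp of t are the stars of the elements
  of t above 2d - z.\<close>

lemma card_set_sharp_Int:
  assumes "t \<subseteq> {1..2 * d}" "card t = d" "z \<le> 2 * d"
  shows "card (set_sharp d t \<inter> {1..z}) + d = z + card (t \<inter> {1..2 * d - z})"
proof -
  let ?B = "t \<inter> {2 * d + 1 - z..2 * d}"
  have fin: "finite t"
    using assms(1) by (rule finite_subset) simp
  have "j \<in> star d ` ?B" if "j \<in> {1..z}" "j \<in> star d ` t" for j
  proof -
    from that(2) obtain i where "i \<in> t" "j = star d i" by blast
    moreover have "i \<in> {1..2 * d}"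
      using \<open>i \<in> t\<close> assms(1) by blast
    ultimately show ?thesis
      using that(1) by (intro image_eqI[of _ _ i]) (auto simp: star_def)
  qed
  moreover have "star d ` ?B \<subseteq> {1..z}"
    using assms by (auto simp: star_def)
  ultimately have sharp: "set_sharp d t \<inter> {1..z} = {1..z} - star d ` ?B" and sub: "star d ` ?B \<subseteq> {1..z}"
    using assms(3) by (auto simp: set_sharp_def)
  have B: "card (star d ` ?B) = card ?B"
    by (rule card_image) (use assms in \<open>auto simp: inj_on_def star_def\<close>)
  then have le: "card ?B \<le> z"
    using card_mono[OF _ sub] by simp
  have "t = ?B \<union> (t \<inter> {1..2 * d - z})"
    using assms by auto
  then have "card t = card ?B + card (t \<inter> {1..2 * d - z})"
    using fin by (subst card_Un_disjoint[symmetric]) auto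
  moreover have "card (set_sharp d t \<inter> {1..z}) = z - card ?B"
    unfolding sharp using sub fin B by (subst card_Diff_subset) auto
  ultimately show ?thesis
    using assms(2) le by linarith
qed

lemma root_sharp_root_sharp: "p \<in> roots d v \<Longrightarrow> v \<subseteq> {1..2 * d} \<Longrightarrow> root_sharp d (root_sharp d p) = p"
  by (cases p) (auto simp: roots_def root_sharp_def star_def)

lemma set_sharp_mem_iff:
  assumes "t \<subseteq> {1..2 * d}" "j \<in> {1..2 * d}"
  shows "j \<in> set_sharp d t \<longleftrightarrow> star d j \<notin> t"
proof -
  have "j \<in> star d ` t \<longleftrightarrow> star d j \<in> t"
    using assms by (force simp: star_def image_iff)
  then show ?thesis using assms(2) by (simp add: set_sharp_def)
qed

lemma set_sharp_subset: "set_sharp d t \<subseteq> {1..2 * d}"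
  by (auto simp: set_sharp_def)

text \<open>Here g grows no faster than h from a common start, so it never gets ahead; and a
  shortfall would persist up to n, against \<open>h n <= g n\<close>.\<close>

lemma increments_eq:
  fixes g h :: "nat \<Rightarrow> nat"
  assumes "g 0 = h 0" "h n \<le> g n" and step: "\<And>k. k < n \<Longrightarrow> g (Suc k) + h k \<le> h (Suc k) + g k"
  shows "k \<le> n \<Longrightarrow> g k = h k"
proof (rule antisym)
  assume k: "k \<le> n"
  show "g k \<le> h k"
    using k
  proof (induction k)
    case (Suc k)
    then show ?case using step[of k] by simp
  qed (use assms in simp)
  show "h k \<le> g k"
    using k
  proof (induction rule: inc_induct)
    case (step m)
    then show ?case using assms(3)[of m] by simp
  qed (use assms in simp)
qed

locale KR_sym =
  fixes d :: nat and v :: "nat set"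
  assumes v_sym: "v \<in> sym_subsets_d d"

sublocale KR_sym \<subseteq> KR
  using v_sym by unfold_locales (auto simp: sym_subsets_d_def subsets_d_def)

section \<open>Reflection of monomials, counts and depths\<close>

context KR_sym
begin

abbreviation (input) "sharp \<equiv> image_mset (root_sharp d)"

lemma card_v: "card v = d"
  using v_sym by (simp add: sym_subsets_d_def subsets_d_def)

lemma v_mem_iff: "j \<in> {1..2 * d} \<Longrightarrow> star d j \<in> v \<longleftrightarrow> j \<notin> v"
proof -
  assume j: "j \<in> {1..2 * d}"
  have *: "(i \<in> v) \<noteq> (star d i \<in> v)" if "i \<in> {1..d}" for i
    using v_sym that by (auto simp: sym_subsets_d_def)
  show ?thesis
  proof (cases "j \<le> d")
    case True
    then show ?thesis using *[of j] j by auto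
  next
    case False
    then have "star d j \<in> {1..d}" "star d (star d j) = j"
      using j by (auto simp: star_def)
    then show ?thesis using *[of "star d j"] by auto
  qed
qed

lemma set_sharp_v: "set_sharp d v = v"
proof -
  have "j \<in> set_sharp d v \<longleftrightarrow> j \<in> v" if "j \<in> {1..2 * d}" for j
    using set_sharp_mem_iff[OF v_subset that] v_mem_iff[OF that] by simp
  then show ?thesis
    using v_subset set_sharp_subset[of d v] by blast
qed

lemma root_sharp_in_roots: "p \<in> roots d v \<Longrightarrow> root_sharp d p \<in> roots d v"
proof -
  assume p: "p \<in> roots d v"
  obtain r c where rc: "p = (r, c)" by (cases p)
  then have "r \<in> {1..2 * d}" "c \<in> {1..2 * d}" "r \<notin> v" "c \<in> v" "c < r"
    using p v_subset by (auto simp: roots_def)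
  then show ?thesis
    using v_mem_iff[of r] v_mem_iff[of c] by (auto simp: rc roots_def root_sharp_def star_def)
qed

lemma monomial_sharp: "monomial d v S \<Longrightarrow> monomial d v (sharp S)"
  using root_sharp_in_roots by (auto simp: monomial_def)

lemma sharp_sharp: "monomial d v S \<Longrightarrow> sharp (sharp S) = S"
proof -
  assume S: "monomial d v S"
  have "sharp (sharp S) = image_mset (\<lambda>p. p) S"
    unfolding multiset.map_comp
    using S root_sharp_root_sharp[OF _ v_subset] by (intro image_mset_cong) (auto simp: monomial_def)
  then show ?thesis by simp
qed

lemma qcount_sharp:
  assumes "monomial d v S" "x \<le> 2 * d" "y \<le> 2 * d"
  shows "qcount (sharp S) y x = qcount S (2 * d - x) (2 * d - y)"
proof -
  have "{#p \<in># S. root_sharp d p \<in> quadrant y x#} = {#p \<in># S. p \<in> quadrant (2 * d - x) (2 * d - y)#}"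
    using assms quadrant_root_sharp[OF _ v_subset assms(2,3)]
    by (intro filter_mset_cong) (auto simp: monomial_def)
  then show ?thesis
    by (simp add: qcount_def filter_mset_image_mset)
qed

text \<open>Reflection swaps rows with columns and reverses both orders, so \<open>gt\<close> is
  preserved and a chain maps to a chain in the same sequence. Since sharp is an involution on
  monomials, the opposite inequality follows from this one.\<close>

lemma depth_sharp_le:
  assumes "monomial d v S" "x \<le> 2 * d" "y \<le> 2 * d"
  shows "depth S (2 * d - x) (2 * d - y) \<le> depth (sharp S) y x"
proof -
  obtain xs where xs: "chain_in S xs" "set xs \<subseteq> quadrant (2 * d - x) (2 * d - y)"
      "length xs = depth S (2 * d - x) (2 * d - y)"
    by (rule depth_chain)
  have root: "p \<in> roots d v" if "p \<in> set xs" for p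
    using that xs(1) assms(1) by (auto simp: chain_in_def monomial_def)
  have "gt (root_sharp d p) (root_sharp d q)" if "p \<in> set xs" "q \<in> set xs" "gt p q" for p q
    using root[OF that(1)] root[OF that(2)] that(3) v_subset
    by (cases p; cases q) (force simp: roots_def gt_def root_sharp_def star_def)
  then have "sorted_wrt (\<lambda>p q. gt (root_sharp d p) (root_sharp d q)) xs"
    using xs(1) unfolding chain_in_def by (blast intro: sorted_wrt_mono_rel)
  then have "chain_in (sharp S) (map (root_sharp d) xs)"
    using xs(1) by (auto simp: chain_in_def sorted_wrt_map)
  moreover have "set (map (root_sharp d) xs) \<subseteq> quadrant y x"
    using xs(2) root quadrant_root_sharp[OF _ v_subset assms(2,3)] by auto
  ultimately show ?thesis
    using length_le_depth xs(3) by fastforce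
qed

lemma depth_sharp:
  assumes "monomial d v S" "x \<le> 2 * d" "y \<le> 2 * d"
  shows "depth (sharp S) y x = depth S (2 * d - x) (2 * d - y)"
proof (rule antisym)
  show "depth (sharp S) y x \<le> depth S (2 * d - x) (2 * d - y)"
    using depth_sharp_le[OF monomial_sharp[OF assms(1)], of "2 * d - y" "2 * d - x"]
      assms sharp_sharp[OF assms(1)] by simp
qed (rule depth_sharp_le[OF assms])

lemma KR_rel_card:
  assumes "KR_rel d v S w S'"
  shows "card w = d"
proof -
  have "card (v \<inter> {1..2 * d}) = card (w \<inter> {1..2 * d}) + depth S (2 * d) (2 * d)"
      "w \<inter> {1..2 * d} = w" "v \<inter> {1..2 * d} = v"
    using assms v_subset unfolding KR_rel_def by blast+
  moreover have "depth S (2 * d) (2 * d) = 0"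
    using assms by (intro depth_top[of d v]) (auto simp: KR_rel_def)
  ultimately show ?thesis
    by (simp add: card_v)
qed

text \<open>Reflection in the antidiagonal turns a relation into a relation, so by uniqueness
  symmetry passes both from the preimage to the image and back.\<close>

lemma KR_rel_sharp:
  assumes rel: "KR_rel d v S w S'"
  shows "KR_rel d v (sharp S) (set_sharp d w) (sharp S')"
proof -
  have S: "monomial d v S" and S': "monomial d v S'" and w: "w \<subseteq> {1..2 * d}"
    and q: "\<And>x y. x \<le> y \<Longrightarrow> qcount S y x = qcount S' y x + depth S y x"
    and c: "\<And>z. card (v \<inter> {1..z}) = card (w \<inter> {1..z}) + depth S z z"
    using rel by (auto simp: KR_rel_def)
  have "qcount (sharp S) y x = qcount (sharp S') y x + depth (sharp S) y x" if "x \<le> y" for x y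
  proof (cases "y \<le> 2 * d")
    case True
    then show ?thesis
      using that q[of "2 * d - y" "2 * d - x"]
      by (simp add: qcount_sharp[OF S] qcount_sharp[OF S'] depth_sharp[OF S])
  next
    \<comment> \<open>The reflection formulas hold up to 2d only; above it all three terms
      vanish.\<close>
    case False
    then show ?thesis
      using qcount_top[OF monomial_sharp[OF S]] qcount_top[OF monomial_sharp[OF S']]
        depth_top[OF monomial_sharp[OF S]] by simp
  qed
  moreover have "card (v \<inter> {1..z}) = card (set_sharp d w \<inter> {1..z}) + depth (sharp S) z z" for z
  proof (cases "z \<le> 2 * d")
    case True
    then show ?thesis
      using card_set_sharp_Int[OF v_subset card_v True] card_set_sharp_Int[OF w KR_rel_card[OF rel] True]
        c[of "2 * d - z"] by (simp add: set_sharp_v depth_sharp[OF S])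
  next
    case False
    have "card (set_sharp d w \<inter> {1..2 * d}) = d"
      using card_set_sharp_Int[OF w KR_rel_card[OF rel], of "2 * d"] by simp
    moreover have "set_sharp d w \<inter> {1..2 * d} = set_sharp d w" "set_sharp d w \<inter> {1..z} = set_sharp d w"
        "v \<inter> {1..z} = v"
      using False v_subset set_sharp_subset[of d w] by fastforce+
    moreover have "depth (sharp S) z z = 0"
      using False by (intro depth_top[OF monomial_sharp[OF S]]) simp
    ultimately show ?thesis
      by (simp add: card_v)
  qed
  ultimately show ?thesis
    using monomial_sharp[OF S] monomial_sharp[OF S'] set_sharp_subset
    unfolding KR_rel_def by blast
qed

lemma KR_rel_sharp_image:
  assumes "KR_rel d v S w S'" "sharp S = S"
  shows "set_sharp d w = w" "sharp S' = S'"
  using KR_rel_image_unique[OF KR_rel_sharp[OF assms(1), unfolded assms(2)] assms(1)] by auto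

lemma KR_rel_sharp_preimage:
  assumes "KR_rel d v S w S'" "set_sharp d w = w" "sharp S' = S'"
  shows "sharp S = S"
  using KR_rel_inj[OF KR_rel_sharp[OF assms(1), unfolded assms(2,3)] assms(1)] .

section \<open>Parity on the antidiagonal\<close>

definition anti_count :: "(nat \<times> nat) multiset \<Rightarrow> nat \<Rightarrow> nat" where
  "anti_count S k = count S (2 * d - k, Suc k)"

definition anti_depth :: "(nat \<times> nat) multiset \<Rightarrow> nat \<Rightarrow> nat" where
  "anti_depth S k = depth S (2 * d - k) k"

lemma special_iff:
  "special d v S \<longleftrightarrow> monomial d v S \<and> sharp S = S \<and> (\<forall>k<d. even (anti_count S k))"
proof (cases "monomial d v S")
  case True
  have "(\<forall>r c. (r, c) \<in># S \<and> c = star d r \<longrightarrow> even (count S (r, c))) \<longleftrightarrow> (\<forall>k<d. even (anti_count S k))"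
  proof (intro iffI allI impI)
    fix k assume *: "\<forall>r c. (r, c) \<in># S \<and> c = star d r \<longrightarrow> even (count S (r, c))" and "k < d"
    have "Suc k = star d (2 * d - k)"
      using \<open>k < d\<close> by (simp add: star_def)
    then show "even (anti_count S k)"
      using * by (cases "(2 * d - k, Suc k) \<in># S") (auto simp: anti_count_def not_in_iff)
  next
    fix r c assume *: "\<forall>k<d. even (anti_count S k)" and rc: "(r, c) \<in># S \<and> c = star d r"
    then have "r \<le> 2 * d" "c < r"
      using True by (auto simp: monomial_def roots_def)
    then have "2 * d - r < d" "2 * d - (2 * d - r) = r" "Suc (2 * d - r) = c"
      using rc by (auto simp: star_def)
    then show "even (count S (r, c))"
      using * unfolding anti_count_def by metis
  qed
  then show ?thesis by (simp add: special_def)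
qed (simp add: special_def)

lemma anti_depth_0: "monomial d v S \<Longrightarrow> anti_depth S 0 = 0"
  by (simp add: anti_depth_def depth_top)

lemma anti_depth_d: "anti_depth S d = depth S d d"
  by (simp add: anti_depth_def)

lemma anti_depth_step:
  assumes "k < d"
  shows "anti_depth S k \<le> anti_depth S (Suc k)" "anti_depth S (Suc k) \<le> anti_depth S k + 1"
    "0 < anti_count S k \<Longrightarrow> anti_depth S (Suc k) = anti_depth S k + 1"
proof -
  have y: "Suc (2 * d - Suc k) = 2 * d - k"
    using assms by simp
  show "anti_depth S k \<le> anti_depth S (Suc k)"
    unfolding anti_depth_def by (intro depth_mono) auto
  show "anti_depth S (Suc k) \<le> anti_depth S k + 1"
    using depth_step[of S "2 * d - Suc k" k] y by (simp add: anti_depth_def)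
  show "anti_depth S (Suc k) = anti_depth S k + 1" if "0 < anti_count S k"
    using depth_member[of "2 * d - Suc k" k S] that y by (simp add: anti_depth_def anti_count_def)
qed

text \<open>For symmetric \<open>S\<close> the two off-antidiagonal corners of an antidiagonal cell have equal
  depths, so they drop out of the local rule modulo two.\<close>

lemma anti_parity:
  assumes rel: "KR_rel d v S w S'" and "sharp S = S" "k < d"
  shows "even (anti_count S' k + anti_count S k + anti_depth S (Suc k) + anti_depth S k)"
    "0 < anti_count S' k \<Longrightarrow> anti_depth S (Suc k) = anti_depth S k + 1"
proof -
  \<comment> \<open>The cell at \<open>y = 2 * d - Suc k\<close>, \<open>x = k\<close>; the
    condition \<open>k < d\<close> is exactly x < y.\<close>
  have y: "Suc (2 * d - Suc k) = 2 * d - k" "k < 2 * d - Suc k"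
    using assms(3) by simp_all
  have "monomial d v S"
    using rel by (simp add: KR_rel_def)
  then have "depth S (2 * d - Suc k) k = depth S (2 * d - k) (Suc k)"
    using depth_sharp[of S k "2 * d - Suc k"] assms(2,3) by simp
  then show "even (anti_count S' k + anti_count S k + anti_depth S (Suc k) + anti_depth S k)"
    using KR_rel_cell[OF rel y(2)] unfolding y(1) anti_count_def anti_depth_def by presburger
  show "anti_depth S (Suc k) = anti_depth S k + 1" if "0 < anti_count S' k"
    using KR_rel_member[OF rel y(2)] that unfolding y(1) anti_count_def anti_depth_def by simp
qed

end

section \<open>Comparing increments along the antidiagonal, and the two directions of the
  result\<close>

context KR_sym
begin

text \<open>The corner (d, d) lies on the diagonal and on the antidiagonal. The first makes the
  depth there a count at the cut d, hence a degree; the second makes it the total of the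
  antidiagonal increments.\<close>

lemma deg_eq_iff:
  assumes "KR_rel d v S t S'" "KR_rel d v S' u T"
  shows "deg d t = deg d u \<longleftrightarrow> anti_depth S d = anti_depth S' d"
proof -
  have deg: "deg d w + card (w \<inter> {1..d}) = d" if "KR_rel d v R w R'" for R w R'
  proof -
    have "finite w"
      using that by (intro finite_subset[of w "{1..2 * d}"]) (simp_all add: KR_rel_def)
    then show ?thesis
      using KR_rel_card[OF that] card_Int_Diff[of w "{1..d}"] by (simp add: deg_def)
  qed
  have "card (v \<inter> {1..d}) = card (w \<inter> {1..d}) + anti_depth R d" if "KR_rel d v R w R'" for R w R'
    using that unfolding KR_rel_def anti_depth_d by blast
  from this[OF assms(1)] this[OF assms(2)] deg[OF assms(1)] deg[OF assms(2)] show ?thesis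
    by linarith
qed

lemma anti_depth_le:
  assumes "KR_rel d v S w S'"
  shows "anti_depth S' d \<le> anti_depth S d"
  using KR_rel_depth_le[OF assms, of d d] by (simp add: anti_depth_d)

text \<open>With even multiplicities in \<open>S\<close>, those in \<open>S'\<close> have the parity
  of the increment of \<open>S\<close>. If \<open>S'\<close> has nothing on the cell,
  \<open>S\<close> does not rise; if it has something, \<open>S'\<close> itself rises by one. So
  increments of \<open>S\<close> are at most those of \<open>S'\<close>, and the comparison at d
  makes them equal. The parity relation for the second step then leaves \<open>T\<close>
  even.\<close>

lemma parity_forward:
  assumes rel: "KR_rel d v S t S'" "KR_rel d v S' u T"
    and sym: "sharp S = S" "sharp S' = S'"
    and even_S: "\<forall>k<d. even (anti_count S k)"
  shows "anti_depth S d = anti_depth S' d" "\<forall>k<d. even (anti_count T k)"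
proof -
  have mono: "monomial d v S" "monomial d v S'"
    using rel by (auto simp: KR_rel_def)
  have step: "anti_depth S (Suc k) + anti_depth S' k \<le> anti_depth S' (Suc k) + anti_depth S k"
    if k: "k < d" for k
  proof (cases "anti_count S' k = 0")
    case True
    moreover have "even (anti_count S k)"
      using even_S k by simp
    ultimately have "anti_depth S (Suc k) = anti_depth S k"
      using anti_parity(1)[OF rel(1) sym(1) k] anti_depth_step(1,2)[OF k, of S] by presburger
    then show ?thesis
      using anti_depth_step(1)[OF k, of S'] by simp
  next
    case False
    then show ?thesis
      using anti_depth_step(2)[OF k, of S] anti_depth_step(3)[OF k, of S'] by simp
  qed
  have eq: "anti_depth S k = anti_depth S' k" if "k \<le> d" for k
    by (rule increments_eq[where n = d, OF _ anti_depth_le[OF rel(1)] step that])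
      (simp_all add: anti_depth_0 mono)
  then show "anti_depth S d = anti_depth S' d"
    by simp
  show "\<forall>k<d. even (anti_count T k)"
  proof (intro allI impI)
    fix k assume k: "k < d"
    have "even (anti_count S' k + anti_depth S (Suc k) + anti_depth S k)"
      using anti_parity(1)[OF rel(1) sym(1) k] even_S k by simp
    moreover have "anti_depth S k = anti_depth S' k" "anti_depth S (Suc k) = anti_depth S' (Suc k)"
      using eq k by simp_all
    ultimately show "even (anti_count T k)"
      using anti_parity(1)[OF rel(2) sym(2) k] by presburger
  qed
qed

text \<open>Now the multiplicities in \<open>S'\<close> have the parity of the increment of
  \<open>S'\<close>. Where \<open>S'\<close> rises its multiplicity is odd, hence positive, and this
  makes \<open>S\<close> rise too; equal totals then turn the inequality of increments into
  equality.\<close>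

lemma parity_backward:
  assumes rel: "KR_rel d v S t S'" "KR_rel d v S' u T"
    and sym: "sharp S = S" "sharp S' = S'"
    and even_T: "\<forall>k<d. even (anti_count T k)" and eq_d: "anti_depth S d = anti_depth S' d"
  shows "\<forall>k<d. even (anti_count S k)"
proof -
  have mono: "monomial d v S" "monomial d v S'"
    using rel by (auto simp: KR_rel_def)
  have even_sum: "even (anti_count S' k + anti_depth S' (Suc k) + anti_depth S' k)" if "k < d" for k
    using anti_parity(1)[OF rel(2) sym(2) that] even_T that by simp
  have step: "anti_depth S' (Suc k) + anti_depth S k \<le> anti_depth S (Suc k) + anti_depth S' k"
    if k: "k < d" for k
  proof (cases "anti_depth S' (Suc k) = anti_depth S' k")
    case True
    then show ?thesis
      using anti_depth_step(1)[OF k, of S] by simp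
  next
    case False
    then have jump: "anti_depth S' (Suc k) = anti_depth S' k + 1"
      using anti_depth_step(1,2)[OF k, of S'] by linarith
    then have "odd (anti_count S' k)"
      using even_sum[OF k] by presburger
    then show ?thesis
      using anti_parity(2)[OF rel(1) sym(1) k] jump odd_pos by simp
  qed
  have eq: "anti_depth S' k = anti_depth S k" if "k \<le> d" for k
    by (rule increments_eq[where g = "anti_depth S'" and h = "anti_depth S" and n = d, OF _ _ step that])
      (simp_all add: anti_depth_0 mono eq_d)
  show ?thesis
  proof (intro allI impI)
    fix k assume k: "k < d"
    have "anti_depth S' k = anti_depth S k" "anti_depth S' (Suc k) = anti_depth S (Suc k)"
      using eq k by simp_all
    then show "even (anti_count S k)"
      using anti_parity(1)[OF rel(1) sym(1) k] even_sum[OF k] by presburger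
  qed
qed

lemma KR_rel_subsets_d: "KR_rel d v S w S' \<Longrightarrow> w \<in> subsets_d d"
  using KR_rel_card[of S w S'] by (simp add: KR_rel_def subsets_d_def)

lemma set_le_iff_subsets_d:
  assumes "u \<in> subsets_d d" "x \<in> subsets_d d"
  shows "set_le u x \<longleftrightarrow> (\<forall>z. card (x \<inter> {1..z}) \<le> card (u \<inter> {1..z}))"
  using assms by (intro set_le_iff_card) (auto simp: subsets_d_def)

lemma dominates_iff_subsets_d:
  assumes "w \<in> subsets_d d" "monomial d v M"
  shows "dominates v w M \<longleftrightarrow> (\<forall>z. card (w \<inter> {1..z}) + depth M z z \<le> card (v \<inter> {1..z}))"
  using assms by (intro dominates_iff_depth) (auto simp: subsets_d_def card_v)

lemma v_in_subsets_d: "v \<in> subsets_d d"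
  using v_sym by (simp add: sym_subsets_d_def)

lemma special_forward:
  assumes special: "special d v S" and pi: "KR_pi v S = (t, S')" "KR_pi v S' = (u, T)"
  shows "t \<in> subsets_d d \<and> u \<in> subsets_d d \<and>
    set_le u t \<and> set_le v u \<and> set_sharp d t = t \<and> set_sharp d u = u \<and>
    deg d t = deg d u \<and> special d v T \<and> dominates v u T"
proof -
  have S: "monomial d v S" "sharp S = S" "\<forall>k<d. even (anti_count S k)"
    using special by (auto simp: special_iff)
  have rel: "KR_rel d v S t S'"
    using KR_pi_rel[OF S(1) pi(1)] .
  then have S': "monomial d v S'"
    by (simp add: KR_rel_def)
  have rel': "KR_rel d v S' u T"
    using KR_pi_rel[OF S' pi(2)] .
  then have T: "monomial d v T"
    by (simp add: KR_rel_def)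
  have sym: "set_sharp d t = t" "sharp S' = S'"
    using KR_rel_sharp_image[OF rel S(2)] .
  have sym': "set_sharp d u = u" "sharp T = T"
    using KR_rel_sharp_image[OF rel' sym(2)] .
  have t: "card (v \<inter> {1..z}) = card (t \<inter> {1..z}) + depth S z z" for z
    using rel by (simp add: KR_rel_def)
  have u: "card (v \<inter> {1..z}) = card (u \<inter> {1..z}) + depth S' z z" for z
    using rel' by (simp add: KR_rel_def)
  have sub: "t \<in> subsets_d d" "u \<in> subsets_d d"
    using rel rel' by (blast intro: KR_rel_subsets_d)+
  have "card (t \<inter> {1..z}) \<le> card (u \<inter> {1..z})" for z
    using t[of z] u[of z] KR_rel_depth_le[OF rel, of z z] by linarith
  then have "set_le u t"
    by (simp only: set_le_iff_subsets_d[OF sub(2,1)]) blast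
  moreover have "card (u \<inter> {1..z}) \<le> card (v \<inter> {1..z})" for z
    using u[of z] by linarith
  then have "set_le v u"
    by (simp only: set_le_iff_subsets_d[OF v_in_subsets_d sub(2)]) blast
  moreover have "deg d t = deg d u"
    using deg_eq_iff[OF rel rel'] parity_forward(1)[OF rel rel' S(2) sym(2) S(3)] by blast
  moreover have "special d v T"
    using parity_forward(2)[OF rel rel' S(2) sym(2) S(3)] T sym'(2) by (simp add: special_iff)
  moreover have "card (u \<inter> {1..z}) + depth T z z \<le> card (v \<inter> {1..z})" for z
    using u[of z] KR_rel_depth_le[OF rel', of z z] by linarith
  then have "dominates v u T"
    by (simp only: dominates_iff_subsets_d[OF sub(2) T]) blast
  ultimately show ?thesis
    using sub sym(1) sym'(1) by blast
qed

lemma KR_phi_inverse: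
  assumes "w \<in> subsets_d d" "monomial d v M"
    and "\<And>z. card (w \<inter> {1..z}) + depth M z z \<le> card (v \<inter> {1..z})"
  shows "KR_rel d v (KR_phi d v (w, M)) w M"
proof -
  have "w \<subseteq> {1..2 * d}" "card w = card v"
    using assms(1) card_v by (simp_all add: subsets_d_def)
  then obtain S where "monomial d v S" "KR_pi v S = (w, M)"
    using KR_pi_surj[OF _ _ assms(2,3)] by blast
  then have image: "(w, M) \<in> KR_pi v ` {S. monomial d v S}"
    by (intro image_eqI[of _ _ S]) simp_all
  have "monomial d v (KR_phi d v (w, M))"
    using inv_into_into[OF image] by (simp add: KR_phi_def)
  moreover have "KR_pi v (KR_phi d v (w, M)) = (w, M)"
    unfolding KR_phi_def by (rule f_inv_into_f[OF image])
  ultimately show ?thesis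
    by (rule KR_pi_rel)
qed

lemma special_backward:
  assumes sub: "t \<in> subsets_d d" "u \<in> subsets_d d" and T: "monomial d v T"
    and le: "set_le u t" and sharp: "set_sharp d t = t" "set_sharp d u = u"
    and deg: "deg d t = deg d u" and special: "special d v T" and dom: "dominates v u T"
  shows "special d v (KR_phi d v (t, KR_phi d v (u, T)))"
proof -
  define S' where "S' = KR_phi d v (u, T)"
  define S where "S = KR_phi d v (t, S')"
  have "card (u \<inter> {1..z}) + depth T z z \<le> card (v \<inter> {1..z})" for z
    using dom unfolding dominates_iff_subsets_d[OF sub(2) T] by (rule spec)
  then have rel': "KR_rel d v S' u T"
    unfolding S'_def using sub(2) T by (intro KR_phi_inverse)
  then have S': "monomial d v S'" and u: "\<And>z. card (v \<inter> {1..z}) = card (u \<inter> {1..z}) + depth S' z z"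
    by (auto simp: KR_rel_def)
  have "card (t \<inter> {1..z}) \<le> card (u \<inter> {1..z})" for z
    using le set_le_iff_subsets_d[OF sub(2,1)] by blast
  \<comment> \<open>The bound for \<open>S'\<close> holds with equality for u, so it passes to every
    t >= u.\<close>
  then have "card (t \<inter> {1..z}) + depth S' z z \<le> card (v \<inter> {1..z})" for z
    using u[of z] by simp
  then have rel: "KR_rel d v S t S'"
    unfolding S_def using sub(1) S' by (intro KR_phi_inverse)
  have "sharp T = T" and even_T: "\<forall>k<d. even (anti_count T k)"
    using special by (auto simp: special_iff)
  then have sym': "sharp S' = S'"
    using KR_rel_sharp_preimage[OF rel' sharp(2)] by blast
  then have sym: "sharp S = S"
    using KR_rel_sharp_preimage[OF rel sharp(1)] by blast
  have "anti_depth S d = anti_depth S' d"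
    using deg_eq_iff[OF rel rel'] deg by blast
  then have "\<forall>k<d. even (anti_count S k)"
    by (rule parity_backward[OF rel rel' sym sym' even_T])
  moreover have "monomial d v S"
    using rel by (simp add: KR_rel_def)
  ultimately show ?thesis
    using sym by (simp add: special_iff S_def S'_def)
qed

end

theorem proposition5p5:
  fixes d :: nat and v :: "nat set"
  assumes "d > 0" and "v \<in> sym_subsets_d d"
  shows
    "(\<forall>S S' T t u.
        special d v S \<and> KR_pi v S = (t, S') \<and> KR_pi v S' = (u, T) \<longrightarrow>
        t \<in> subsets_d d \<and> u \<in> subsets_d d \<and>
        set_le u t \<and> set_le v u \<and> set_sharp d t = t \<and> set_sharp d u = u \<and>
        deg d t = deg d u \<and>
        special d v T \<and> dominates v u T)
     \<and>
     (\<forall>t u T.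
        t \<in> subsets_d d \<and> u \<in> subsets_d d \<and> monomial d v T \<and>
        set_le u t \<and> set_le v u \<and> set_sharp d t = t \<and> set_sharp d u = u \<and>
        deg d t = deg d u \<and>
        special d v T \<and> dominates v u T \<longrightarrow>
        special d v (KR_phi d v (t, KR_phi d v (u, T))))"
proof -
  interpret KR_sym d v
    by unfold_locales (rule assms(2))
  show ?thesis
    by (intro conjI[where P = "All _"] allI impI; elim conjE)
      (rule special_forward special_backward; assumption)+
qed

end
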